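(* The isomorphism relation $\cong_{\mathcal{UF}^2_1}$ on c.e. presentations of $1$-generated algebras with two unary function symbols is a $\Sigma^0_3$-complete equivalence relation: it is $\Sigma^0_3$, and every $\Sigma^0_3$ equivalence relation on $\mathbb N$ is computably reducible to it.
   Context: $W_e$ denotes the $e$-th c.e. set. $\mathcal{UF}^2$ is the variety of all algebras in the signature consisting of two unary function symbols $f,g$, with no equational laws. Fix a computable bijective coding of pairs of terms over the single generator $x_0$ by natural numbers. $\mathcal{UF}^2_1[e]$ is the term algebra over $\{x_0\}$ modulo the smallest congruence containing all pairs coded in $W_e$, and $e\cong_{\mathcal{UF}^2_1}i$ iff $\mathcal{UF}^2_1[e]\cong\mathcal{UF}^2_1[i]$. For equivalence relations $E,F$ on $\mathbb N$, $E\le_c F$ (computable reducibility) means there is a total computable $h$ with $x\,E\,y\iff h(x)\,F\,h(y)$. *)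

theory Defs
  imports Main "HOL-Library.Nat_Bijection"
begin

section \<open>Partial recursive functions and c.e. sets\<close>

text \<open>
  Programs for the partial recursive functions of one argument; several arguments are passed
  through the Cantor pairing \<^term>\<open>prod_encode\<close>. Projections and pairing replace the
  projection functions of the usual multi-argument definition.
\<close>

datatype code =
    Zero
  | Succ
  | Fst
  | Snd
  | Pairing code code
  | Comp code code
  | Prec code code
  | Mu code

text \<open>
  \<^term>\<open>None\<close> means divergence. \<open>Prec c d\<close> maps \<open>(a, 0)\<close> to \<open>c a\<close> and
  \<open>(a, k + 1)\<close> to \<open>d (a, (k, r))\<close>, where \<open>r\<close> is its value at \<open>(a, k)\<close>. \<open>Mu c\<close> is
  unbounded search: the value of \<open>c\<close> has to be defined at all arguments below the zero found.
\<close>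

primrec eval :: "code \<Rightarrow> nat \<Rightarrow> nat option" where
  "eval Zero x = Some 0"
| "eval Succ x = Some (Suc x)"
| "eval Fst x = Some (fst (prod_decode x))"
| "eval Snd x = Some (snd (prod_decode x))"
| "eval (Pairing c d) x =
     Option.bind (eval c x) (\<lambda>y. Option.bind (eval d x) (\<lambda>z. Some (prod_encode (y, z))))"
| "eval (Comp c d) x = Option.bind (eval d x) (eval c)"
| "eval (Prec c d) x =
     (let a = fst (prod_decode x); n = snd (prod_decode x) in
      rec_nat (eval c a)
        (\<lambda>k v. Option.bind v (\<lambda>r. eval d (prod_encode (a, prod_encode (k, r))))) n)"
| "eval (Mu c) x =
     (if \<exists>n. eval c (prod_encode (x, n)) = Some 0 \<and>
             (\<forall>m<n. \<exists>y. eval c (prod_encode (x, m)) = Some (Suc y))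
      then Some (LEAST n. eval c (prod_encode (x, n)) = Some 0)
      else None)"

text \<open>A bijective Goedel numbering of programs.\<close>

primrec code_encode :: "code \<Rightarrow> nat" where
  "code_encode Zero = 0"
| "code_encode Succ = 1"
| "code_encode Fst = 2"
| "code_encode Snd = 3"
| "code_encode (Pairing c d) = 4 * prod_encode (code_encode c, code_encode d) + 4"
| "code_encode (Comp c d) = 4 * prod_encode (code_encode c, code_encode d) + 5"
| "code_encode (Prec c d) = 4 * prod_encode (code_encode c, code_encode d) + 6"
| "code_encode (Mu c) = 4 * code_encode c + 7"

lemma code_encode_mod_4:
  "code_encode Zero mod 4 = 0" "code_encode Succ mod 4 = 1"
  "code_encode Fst mod 4 = 2" "code_encode Snd mod 4 = 3"
  "code_encode (Pairing c d) mod 4 = 0" "code_encode (Comp c d) mod 4 = 1"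
  "code_encode (Prec c d) mod 4 = 2" "code_encode (Mu c) mod 4 = 3"
  by (simp, simp, simp, simp, simp, (simp only: code_encode.simps, presburger)+)

lemma code_encode_div_4:
  "code_encode Zero div 4 = 0" "code_encode Succ div 4 = 0"
  "code_encode Fst div 4 = 0" "code_encode Snd div 4 = 0"
  "code_encode (Pairing c d) div 4 = Suc (prod_encode (code_encode c, code_encode d))"
  "code_encode (Comp c d) div 4 = Suc (prod_encode (code_encode c, code_encode d))"
  "code_encode (Prec c d) div 4 = Suc (prod_encode (code_encode c, code_encode d))"
  "code_encode (Mu c) div 4 = Suc (code_encode c)"
proof -
  have "(4 * m + 4) div 4 = Suc m" "(4 * m + 5) div 4 = Suc m"
       "(4 * m + 6) div 4 = Suc m" "(4 * m + 7) div 4 = Suc m" for m :: nat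
    by presburger+
  note div = this
  show "code_encode (Pairing c d) div 4 = Suc (prod_encode (code_encode c, code_encode d))"
    "code_encode (Comp c d) div 4 = Suc (prod_encode (code_encode c, code_encode d))"
    "code_encode (Prec c d) div 4 = Suc (prod_encode (code_encode c, code_encode d))"
    "code_encode (Mu c) div 4 = Suc (code_encode c)"
    by (simp_all only: code_encode.simps div)
qed simp_all

lemma inj_code_encode: "inj code_encode"
proof (rule injI)
  have "code_encode c mod 4 = code_encode d mod 4 \<Longrightarrow>
        code_encode c div 4 = code_encode d div 4 \<Longrightarrow> c = d" for c d
  proof (induction c arbitrary: d)
    case Zero then show ?case
      by (cases d) (simp_all add: code_encode_mod_4 code_encode_div_4 del: code_encode.simps)
  next
    case Succ then show ?case
      by (cases d) (simp_all add: code_encode_mod_4 code_encode_div_4 del: code_encode.simps)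
  next
    case Fst then show ?case
      by (cases d) (simp_all add: code_encode_mod_4 code_encode_div_4 del: code_encode.simps)
  next
    case Snd then show ?case
      by (cases d) (simp_all add: code_encode_mod_4 code_encode_div_4 del: code_encode.simps)
  next
    case (Pairing c1 c2) then show ?case
      by (cases d) (simp_all add: code_encode_mod_4 code_encode_div_4 del: code_encode.simps)
  next
    case (Comp c1 c2) then show ?case
      by (cases d) (simp_all add: code_encode_mod_4 code_encode_div_4 del: code_encode.simps)
  next
    case (Prec c1 c2) then show ?case
      by (cases d) (simp_all add: code_encode_mod_4 code_encode_div_4 del: code_encode.simps)
  next
    case (Mu c) then show ?case
      by (cases d) (simp_all add: code_encode_mod_4 code_encode_div_4 del: code_encode.simps)
  qed
  then show "code_encode c = code_encode d \<Longrightarrow> c = d" for c d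
    by metis
qed

lemma surj_code_encode: "surj code_encode"
proof -
  have "n \<in> range code_encode" for n
  proof (induction n rule: less_induct)
    case (less n)
    show ?case
    proof (cases "n < 4")
      case True
      then have "n = code_encode Zero \<or> n = code_encode Succ \<or> n = code_encode Fst \<or> n = code_encode Snd"
        by auto
      then show ?thesis by blast
    next
      case False
      define m where "m = (n - 4) div 4"
      have n: "n = 4 * m + 4 \<or> n = 4 * m + 5 \<or> n = 4 * m + 6 \<or> n = 4 * m + 7"
        using False unfolding m_def by presburger
      have "m < n" using False unfolding m_def by presburger
      obtain a b where ab: "m = prod_encode (a, b)"
        by (metis prod_decode_inverse surj_pair)
      then have "a < n" "b < n"
        using \<open>m < n\<close> le_prod_encode_1[of a b] le_prod_encode_2[of b a] by linarith+
      with less.IH obtain c d where "code_encode c = a" "code_encode d = b" by fastforce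
      moreover obtain e where "code_encode e = m" using less.IH[OF \<open>m < n\<close>] by auto
      ultimately
      have
        "4 * m + 4 = code_encode (Pairing c d)" "4 * m + 5 = code_encode (Comp c d)"
        "4 * m + 6 = code_encode (Prec c d)" "4 * m + 7 = code_encode (Mu e)" using ab by simp_all
      with n show ?thesis by (elim disjE) (simp_all only: rangeI)
    qed
  qed
  then show ?thesis by blast
qed

definition code_decode :: "nat \<Rightarrow> code" where
  "code_decode = inv code_encode"

lemma code_decode_encode [simp]: "code_decode (code_encode c) = c"
  unfolding code_decode_def using inj_code_encode by simp

lemma code_encode_decode [simp]: "code_encode (code_decode e) = e"
  unfolding code_decode_def using surj_code_encode by (simp add: surj_f_inv_f)

definition W :: "nat \<Rightarrow> nat set" where
  "W e = {x. eval (code_decode e) x \<noteq> None}"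

definition computable :: "(nat \<Rightarrow> nat) \<Rightarrow> bool" where
  "computable h \<longleftrightarrow> (\<exists>c. \<forall>x. eval c x = Some (h x))"

definition decidable :: "nat set \<Rightarrow> bool" where
  "decidable A \<longleftrightarrow> computable (\<lambda>x. if x \<in> A then 1 else 0)"

definition Sigma03 :: "(nat \<Rightarrow> nat \<Rightarrow> bool) \<Rightarrow> bool" where
  "Sigma03 R \<longleftrightarrow> (\<exists>A. decidable A \<and>
     (\<forall>x y. R x y \<longleftrightarrow>
       (\<exists>a. \<forall>b. \<exists>c.
          prod_encode (x, prod_encode (y, prod_encode (a, prod_encode (b, c)))) \<in> A)))"

definition computably_reducible ::
    "(nat \<Rightarrow> nat \<Rightarrow> bool) \<Rightarrow> (nat \<Rightarrow> nat \<Rightarrow> bool) \<Rightarrow> bool"  (infix "\<le>\<^sub>c" 50) where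
  "E \<le>\<^sub>c F \<longleftrightarrow> (\<exists>h. computable h \<and> (\<forall>x y. E x y \<longleftrightarrow> F (h x) (h y)))"

definition Sigma03_complete_equivalence :: "(nat \<Rightarrow> nat \<Rightarrow> bool) \<Rightarrow> bool" where
  "Sigma03_complete_equivalence F \<longleftrightarrow>
     equivp F \<and> Sigma03 F \<and> (\<forall>E. equivp E \<and> Sigma03 E \<longrightarrow> E \<le>\<^sub>c F)"


section \<open>Algebras with two unary operations\<close>

record 'a alg =
  carrier :: "'a set"
  fop :: "'a \<Rightarrow> 'a"
  gop :: "'a \<Rightarrow> 'a"

definition UF2 :: "'a alg set" where
  "UF2 = {A. fop A ` carrier A \<subseteq> carrier A \<and> gop A ` carrier A \<subseteq> carrier A}"

definition isomorphic :: "'a alg \<Rightarrow> 'b alg \<Rightarrow> bool" where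
  "isomorphic A B \<longleftrightarrow>
     (\<exists>h. bij_betw h (carrier A) (carrier B) \<and>
          (\<forall>x\<in>carrier A. h (fop A x) = fop B (h x) \<and> h (gop A x) = gop B (h x)))"

definition congruence :: "'a alg \<Rightarrow> ('a \<times> 'a) set \<Rightarrow> bool" where
  "congruence A \<theta> \<longleftrightarrow> equiv (carrier A) \<theta> \<and>
     (\<forall>(x, y)\<in>\<theta>. (fop A x, fop A y) \<in> \<theta> \<and> (gop A x, gop A y) \<in> \<theta>)"

definition generated_congruence :: "'a alg \<Rightarrow> ('a \<times> 'a) set \<Rightarrow> ('a \<times> 'a) set" where
  "generated_congruence A S = \<Inter> {\<theta>. congruence A \<theta> \<and> S \<subseteq> \<theta>}"

text \<open>
  The operations send the class of \<open>x\<close> to the class of \<open>f x\<close>; for a congruence the union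
  is over equal classes.
\<close>

definition quotient_alg :: "'a alg \<Rightarrow> ('a \<times> 'a) set \<Rightarrow> 'a set alg" where
  "quotient_alg A \<theta> =
     \<lparr>carrier = carrier A // \<theta>,
      fop = (\<lambda>X. \<Union>x\<in>X. \<theta> `` {fop A x}),
      gop = (\<lambda>X. \<Union>x\<in>X. \<theta> `` {gop A x})\<rparr>"

lemma congruence_generated_congruence:
  assumes "A \<in> UF2" "S \<subseteq> carrier A \<times> carrier A"
  shows "congruence A (generated_congruence A S)"
proof -
  have 0: "congruence A (carrier A \<times> carrier A)"
    using assms(1) by (auto simp: congruence_def UF2_def equiv_def refl_on_def sym_def trans_def)
  let ?T = "generated_congruence A S"
  have sub: "?T \<subseteq> carrier A \<times> carrier A"
    using 0 assms(2) unfolding generated_congruence_def by blast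
  have "equiv (carrier A) ?T"
  proof (rule equivI)
    show "?T \<subseteq> carrier A \<times> carrier A" by (rule sub)
    show "refl_on (carrier A) ?T"
      unfolding generated_congruence_def congruence_def equiv_def refl_on_def by blast
    show "sym ?T"
      unfolding generated_congruence_def congruence_def equiv_def by (auto simp: sym_def)
    show "trans ?T"
    proof (rule transI)
      fix x y z assume xy: "(x, y) \<in> ?T" and yz: "(y, z) \<in> ?T"
      show "(x, z) \<in> ?T"
        unfolding generated_congruence_def
      proof (rule InterI)
        fix \<theta> assume "\<theta> \<in> {\<theta>. congruence A \<theta> \<and> S \<subseteq> \<theta>}"
        then have "trans \<theta>" "(x, y) \<in> \<theta>" "(y, z) \<in> \<theta>"
          using xy yz by (auto simp: generated_congruence_def congruence_def equiv_def)
        then show "(x, z) \<in> \<theta>" by (rule transD)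
      qed
    qed
  qed
  moreover have "(fop A x, fop A y) \<in> ?T \<and> (gop A x, gop A y) \<in> ?T" if "(x, y) \<in> ?T" for x y
    using that unfolding generated_congruence_def congruence_def by blast
  ultimately show ?thesis
    unfolding congruence_def by blast
qed

lemma quotient_alg_class:
  assumes "congruence A \<theta>" "x \<in> carrier A"
  shows "fop (quotient_alg A \<theta>) (\<theta> `` {x}) = \<theta> `` {fop A x}"
    and "gop (quotient_alg A \<theta>) (\<theta> `` {x}) = \<theta> `` {gop A x}"
proof -
  have e: "equiv (carrier A) \<theta>" using assms(1) by (simp add: congruence_def)
  have "(\<lambda>x. \<theta> `` {fop A x}) respects \<theta>" "(\<lambda>x. \<theta> `` {gop A x}) respects \<theta>"
    using assms(1) by (auto simp: congruent_def congruence_def intro!: equiv_class_eq[OF e])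
  then show "fop (quotient_alg A \<theta>) (\<theta> `` {x}) = \<theta> `` {fop A x}"
    and "gop (quotient_alg A \<theta>) (\<theta> `` {x}) = \<theta> `` {gop A x}"
    using UN_equiv_class[OF e _ assms(2)] by (simp_all add: quotient_alg_def)
qed


section \<open>C.e. presentations of 1-generated algebras\<close>

text \<open>Terms over the single generator \<open>x0\<close>, for which \<open>Gen\<close> stands.\<close>

datatype trm = Gen | Ap_f trm | Ap_g trm

definition term_alg :: "trm alg" where
  "term_alg = \<lparr>carrier = UNIV, fop = Ap_f, gop = Ap_g\<rparr>"

text \<open>Terms are words over two letters; they are coded by bijective base-2 numerals.\<close>

primrec trm_encode :: "trm \<Rightarrow> nat" where
  "trm_encode Gen = 0"
| "trm_encode (Ap_f t) = 2 * trm_encode t + 1"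
| "trm_encode (Ap_g t) = 2 * trm_encode t + 2"

lemma bij_trm_encode: "bij trm_encode"
proof (rule bijI)
  have neq: "2 * m + 1 \<noteq> 2 * n + (2 :: nat)" for m n by presburger
  show "inj trm_encode"
  proof (rule injI)
    show "trm_encode s = trm_encode t \<Longrightarrow> s = t" for s t
    proof (induction s arbitrary: t)
      case Gen then show ?case by (cases t) simp_all
    next
      case (Ap_f s) then show ?case using neq by (cases t) (simp_all only: trm_encode.simps, simp_all)
    next
      case (Ap_g s) then show ?case using neq[symmetric] by (cases t) (simp_all only: trm_encode.simps, simp_all)
    qed
  qed
  have "n \<in> range trm_encode" for n
  proof (induction n rule: less_induct)
    case (less n)
    consider "n = 0" | m where "n = 2 * m + 1" | m where "n = 2 * m + 2"
    proof -
      have "n = 0 \<or> n = 2 * ((n - 1) div 2) + 1 \<or> n = 2 * ((n - 1) div 2) + 2" by presburger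
      then show ?thesis using that by blast
    qed
    then show ?case
    proof cases
      case 1 then show ?thesis using rangeI[of trm_encode Gen] by simp
    next
      case (2 m)
      then obtain t where "trm_encode t = m" using less.IH[of m] by auto
      then show ?thesis using 2 rangeI[of trm_encode "Ap_f t"] by simp
    next
      case (3 m)
      then obtain t where "trm_encode t = m" using less.IH[of m] by auto
      then show ?thesis using 3 rangeI[of trm_encode "Ap_g t"] by simp
    qed
  qed
  then show "surj trm_encode" by blast
qed

definition pair_encode :: "trm \<times> trm \<Rightarrow> nat" where
  "pair_encode p = prod_encode (trm_encode (fst p), trm_encode (snd p))"

lemma bij_pair_encode: "bij pair_encode"
proof -
  have "pair_encode = prod_encode \<circ> map_prod trm_encode trm_encode"
    by (auto simp: pair_encode_def fun_eq_iff)
  moreover have "bij (map_prod trm_encode trm_encode)"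
    using bij_trm_encode by (simp add: bij_def prod.inj_map map_prod_surj)
  ultimately show ?thesis by (metis bij_comp bij_prod_encode)
qed

definition UF2_1 :: "nat \<Rightarrow> trm set alg" where
  "UF2_1 e = quotient_alg term_alg (generated_congruence term_alg {p. pair_encode p \<in> W e})"

definition iso_UF2_1 :: "nat \<Rightarrow> nat \<Rightarrow> bool" where
  "iso_UF2_1 e i \<longleftrightarrow> isomorphic (UF2_1 e) (UF2_1 i)"

lemma UF2_1_in_UF2: "UF2_1 e \<in> UF2"
proof -
  let ?T = "generated_congruence term_alg {p. pair_encode p \<in> W e}"
  have "term_alg \<in> UF2" by (simp add: UF2_def term_alg_def)
  then have c: "congruence term_alg ?T"
    by (rule congruence_generated_congruence) (simp add: term_alg_def)
  have "fop (UF2_1 e) X \<in> carrier (UF2_1 e) \<and> gop (UF2_1 e) X \<in> carrier (UF2_1 e)"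
    if X: "X \<in> carrier (UF2_1 e)" for X
  proof -
    obtain x where "X = ?T `` {x}"
      using X by (auto simp: UF2_1_def quotient_alg_def quotient_def)
    then show ?thesis
      using quotient_alg_class[OF c, of x]
      by (auto simp: UF2_1_def term_alg_def quotient_alg_def intro!: quotientI)
  qed
  then show ?thesis by (auto simp: UF2_def)
qed

end

theory Submission
  imports Defs HOL.Rat
begin

text \<open>
  Upper bound: an isomorphism is determined by a term \<open>u\<close> for the image of the generator, and it
  exists iff substituting \<open>u\<close> for the generator preserves and reflects equality (a
  \<open>\<Pi>\<^sub>2\<close> condition, since equality is c.e.) and some \<open>v\<close> satisfies
  \<open>v[u] = x\<^sub>0\<close>.

  Hardness: given a \<open>\<Sigma>\<^sub>3\<close> equivalence relation \<open>E\<close>, attach to each \<open>x\<close> a sequence of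
  lower semicomputable cuts \<open>-1/m\<^sub>c(x)\<close> of the rationals, with \<open>m\<^sub>c(x)\<close> a positive integer or
  infinite, so that \<open>x E y\<close> iff the sequences of \<open>x\<close> and \<open>y\<close> differ in finitely many places. For
  \<open>c = (n, u)\<close>, \<open>m\<^sub>c(x)\<close> is the bottleneck capacity of the best path from \<open>x\<close> to \<open>u\<close> among the
  vertices up to \<open>n\<close>, an edge being as wide as the evidence found so far for \<open>E\<close> by a witness up to
  \<open>n\<close>; this capacity is an ultrametric, so that \<open>x\<close> and \<open>y\<close> at infinite capacity have equal
  capacities to every \<open>u\<close>. The algebra of \<open>x\<close> consists of positions \<open>\<gamma>\<close> in
  the direct sum of countably many copies of the rationals, which the operations translate, and of
  test results: testing \<open>\<gamma>\<close> at \<open>c\<close> gives a fixed sink iff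
  \<open>\<gamma>\<^sub>c < -1/m\<^sub>c(x)\<close>. Moving the generator translates all cuts, and it can do so in finitely many
  coordinates; the limit cut \<open>0\<close> is a translate of all the others, which is why dense orders are
  used instead of integers.
\<close>

section \<open>Computable functions\<close>

definition pr :: "nat \<Rightarrow> nat \<Rightarrow> nat" where "pr a b = prod_encode (a, b)"
definition p1 :: "nat \<Rightarrow> nat" where "p1 z = fst (prod_decode z)"
definition p2 :: "nat \<Rightarrow> nat" where "p2 z = snd (prod_decode z)"

lemma pr_simps [simp]: "p1 (pr a b) = a" "p2 (pr a b) = b" "pr (p1 z) (p2 z) = z"
  by (simp_all add: pr_def p1_def p2_def)

lemma pr_eq_iff [simp]: "pr a b = pr c d \<longleftrightarrow> a = c \<and> b = d"
  by (metis pr_simps(1,2))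

lemma le_pr: "a \<le> pr a b" "b \<le> pr a b"
  by (simp_all add: pr_def le_prod_encode_1 le_prod_encode_2)

lemma computable_const: "computable (\<lambda>x. k)"
proof -
  have "\<exists>c. \<forall>x. eval c x = Some k"
  proof (induction k)
    case 0
    show ?case by (rule exI[of _ Zero]) simp
  next
    case (Suc k)
    then obtain c where "\<forall>x. eval c x = Some k" by blast
    then show ?case by (intro exI[of _ "Comp Succ c"]) simp
  qed
  then show ?thesis by (simp add: computable_def)
qed

lemma computable_id: "computable (\<lambda>x. x)"
  unfolding computable_def by (rule exI[of _ "Pairing Fst Snd"]) simp

lemma computable_compose:
  assumes "computable f" "computable g"
  shows "computable (\<lambda>x. f (g x))"
proof -
  obtain c d where "\<forall>x. eval c x = Some (f x)" "\<forall>x. eval d x = Some (g x)"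
    using assms by (auto simp: computable_def)
  then show ?thesis
    unfolding computable_def by (intro exI[of _ "Comp c d"]) simp
qed

lemma computable_Suc: "computable F \<Longrightarrow> computable (\<lambda>x. Suc (F x))"
  by (rule computable_compose[of Suc]) (auto simp: computable_def intro: exI[of _ Succ])

lemma computable_p1: "computable F \<Longrightarrow> computable (\<lambda>x. p1 (F x))"
  by (rule computable_compose[of p1]) (auto simp: computable_def p1_def intro: exI[of _ Fst])

lemma computable_p2: "computable F \<Longrightarrow> computable (\<lambda>x. p2 (F x))"
  by (rule computable_compose[of p2]) (auto simp: computable_def p2_def intro: exI[of _ Snd])

lemma computable_pr:
  assumes "computable F" "computable G"
  shows "computable (\<lambda>x. pr (F x) (G x))"
proof -
  obtain c d where "\<forall>x. eval c x = Some (F x)" "\<forall>x. eval d x = Some (G x)"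
    using assms by (auto simp: computable_def)
  then show ?thesis
    unfolding computable_def by (intro exI[of _ "Pairing c d"]) (simp add: pr_def)
qed

text \<open>\<open>Prec\<close> keeps its first argument fixed, so the step may depend on the input
  \<open>x\<close>. Applications write the step as a redex \<open>(\<lambda>x k r. ...) x\<close>,
  from which unification reads off \<open>S\<close>.\<close>

lemma computable_rec_nat:
  assumes "computable B" "computable (\<lambda>z. S (p1 z) (p1 (p2 z)) (p2 (p2 z)))" "computable N"
  shows "computable (\<lambda>x. rec_nat (B x) (S x) (N x))"
proof -
  obtain c d where c: "\<forall>x. eval c x = Some (B x)"
    and d: "\<forall>z. eval d z = Some (S (p1 z) (p1 (p2 z)) (p2 (p2 z)))"
    using assms by (auto simp: computable_def)
  have "eval (Prec c d) (prod_encode (x, n)) = Some (rec_nat (B x) (S x) n)" for x n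
    by (induction n) (simp_all add: c d p1_def p2_def)
  then have "computable (\<lambda>z. rec_nat (B (p1 z)) (S (p1 z)) (p2 z))"
    unfolding computable_def p1_def p2_def
    by (metis prod_decode_inverse prod.collapse)
  from computable_compose[OF this computable_pr[OF computable_id assms(3)]]
  show ?thesis by simp
qed

lemma computable_add:
  assumes "computable F" "computable G"
  shows "computable (\<lambda>x. F x + G x)"
proof -
  have *: "rec_nat a (\<lambda>_ r. Suc r) b = a + b" for a b
    by (induction b) simp_all
  have "computable (\<lambda>x. rec_nat (F x) ((\<lambda>x _ r. Suc r) x) (G x))"
    by (intro computable_rec_nat computable_Suc computable_p2 computable_id assms)
  then show ?thesis by (simp only: *)
qed

lemma computable_mult:
  assumes "computable F" "computable G"
  shows "computable (\<lambda>x. F x * G x)"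
proof -
  have *: "rec_nat 0 (\<lambda>_ r. r + a) b = b * a" for a b
    by (induction b) simp_all
  have "computable (\<lambda>x. rec_nat 0 ((\<lambda>x _ r. r + F x) x) (G x))"
    by (intro computable_rec_nat computable_const computable_add computable_p2 computable_id assms
        computable_compose[OF assms(1)] computable_p1)
  then show ?thesis by (simp only: * mult.commute)
qed

lemma computable_diff:
  assumes "computable F" "computable G"
  shows "computable (\<lambda>x. F x - G x)"
proof -
  \<comment> \<open>Predecessor is the recursion whose step returns the counter; truncated
    subtraction iterates it.\<close>
  have pred: "rec_nat 0 (\<lambda>k _. k) b = b - 1" for b :: nat
    by (cases b) simp_all
  have "computable (\<lambda>x. rec_nat 0 ((\<lambda>_ k _. k) x) x)"
    by (intro computable_rec_nat computable_const computable_p1 computable_p2 computable_id)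
  then have pred': "computable (\<lambda>x. x - 1)" by (simp only: pred)
  have *: "rec_nat a (\<lambda>_ r. r - 1) b = a - b" for a b :: nat
    by (induction b) simp_all
  have "computable (\<lambda>x. rec_nat (F x) ((\<lambda>_ _ r. r - 1) x) (G x))"
    by (intro computable_rec_nat computable_compose[OF pred'] computable_p2 computable_id assms)
  then show ?thesis by (simp only: *)
qed

lemmas computable_intros = computable_const computable_id computable_Suc computable_p1
  computable_p2 computable_pr computable_add computable_mult computable_diff

lemma computable_funpow:
  assumes "computable f" "computable F" "computable N"
  shows "computable (\<lambda>x. (f ^^ N x) (F x))"
proof -
  have *: "rec_nat a (\<lambda>_ r. f r) n = (f ^^ n) a" for a n
    by (induction n) simp_all
  have "computable (\<lambda>x. rec_nat (F x) ((\<lambda>_ _ r. f r) x) (N x))"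
    by (intro computable_rec_nat computable_compose[OF assms(1)] computable_intros assms)
  then show ?thesis by (simp only: *)
qed


section \<open>Decidable and semidecidable predicates\<close>

definition dec :: "(nat \<Rightarrow> bool) \<Rightarrow> bool" where
  "dec P \<longleftrightarrow> decidable {x. P x}"

lemma dec_computable: "dec P \<longleftrightarrow> computable (\<lambda>x. if P x then 1 else 0)"
  by (simp add: dec_def decidable_def)

lemma dec_compose: "dec P \<Longrightarrow> computable F \<Longrightarrow> dec (\<lambda>x. P (F x))"
  unfolding dec_computable by (rule computable_compose)

lemma dec_not: "dec P \<Longrightarrow> dec (\<lambda>x. \<not> P x)"
proof -
  assume "dec P"
  then have "computable (\<lambda>x. 1 - (if P x then 1 else 0))"
    unfolding dec_computable by (intro computable_diff computable_const)
  moreover have "1 - (if P x then 1 else 0) = (if \<not> P x then 1 else (0::nat))" for x by simp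
  ultimately show ?thesis unfolding dec_computable by simp
qed

lemma dec_conj: "dec P \<Longrightarrow> dec Q \<Longrightarrow> dec (\<lambda>x. P x \<and> Q x)"
proof -
  assume "dec P" "dec Q"
  then have "computable (\<lambda>x. (if P x then 1 else 0) * (if Q x then 1 else 0))"
    unfolding dec_computable by (intro computable_mult)
  moreover have "(if P x then 1 else 0) * (if Q x then 1 else 0) = (if P x \<and> Q x then 1 else (0::nat))" for x
    by simp
  ultimately show ?thesis unfolding dec_computable by (simp only:)
qed

lemma dec_disj: "dec P \<Longrightarrow> dec Q \<Longrightarrow> dec (\<lambda>x. P x \<or> Q x)"
  using dec_not[OF dec_conj[OF dec_not dec_not], of P Q] by simp

lemma dec_le: "computable F \<Longrightarrow> computable G \<Longrightarrow> dec (\<lambda>x. F x \<le> G x)"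
proof -
  assume "computable F" "computable G"
  then have "computable (\<lambda>x. 1 - (F x - G x))"
    by (intro computable_diff computable_const)
  moreover have "1 - (F x - G x) = (if F x \<le> G x then 1 else 0)" for x
    by simp
  ultimately show ?thesis unfolding dec_computable by (simp only:)
qed

lemma dec_less: "computable F \<Longrightarrow> computable G \<Longrightarrow> dec (\<lambda>x. F x < G x)"
  using dec_not[OF dec_le, of G F] by (simp add: not_le)

lemma dec_eq: "computable F \<Longrightarrow> computable G \<Longrightarrow> dec (\<lambda>x. F x = G x)"
  using dec_conj[OF dec_le dec_le, of F G G F] by (simp add: eq_iff)

lemma dec_ball:
  assumes "dec (\<lambda>z. P (p1 z) (p2 z))" "computable F"
  shows "dec (\<lambda>x. \<forall>m<F x. P x m)"
proof -
  \<comment> \<open>The characteristic value is the product of those below the bound.\<close>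
  have *: "rec_nat 1 (\<lambda>k r. r * (if P x k then 1 else 0)) n = (if \<forall>m<n. P x m then 1 else 0::nat)" for x n
    by (induction n) (auto simp: less_Suc_eq)
  have "computable (\<lambda>x. rec_nat 1 ((\<lambda>x k r. r * (if P x k then 1 else 0)) x) (F x))"
    using dec_compose[OF assms(1) computable_pr[OF computable_p1 computable_p1[OF computable_p2]],
        OF computable_id computable_id]
    unfolding dec_computable pr_simps
    by (intro computable_rec_nat computable_intros assms(2))
  then show ?thesis unfolding dec_computable by (simp only: *)
qed

lemma dec_bex:
  assumes "dec (\<lambda>z. P (p1 z) (p2 z))" "computable F"
  shows "dec (\<lambda>x. \<exists>m<F x. P x m)"
  using dec_not[OF dec_ball[where P = "\<lambda>x m. \<not> P x m", OF dec_not]] assms by simp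

text \<open>The projective form turns closure under quantifiers into a re-pairing of witnesses. The
  link with domains of programs is made by \<open>semidec_domain\<close> and
  \<open>semidec_W\<close>.\<close>

definition semidec :: "(nat \<Rightarrow> bool) \<Rightarrow> bool" where
  "semidec P \<longleftrightarrow> (\<exists>B. dec B \<and> (\<forall>x. P x \<longleftrightarrow> (\<exists>y. B (pr x y))))"

lemma semidecI: "dec (\<lambda>z. B (p1 z) (p2 z)) \<Longrightarrow> semidec (\<lambda>x. \<exists>y. B x y)"
  unfolding semidec_def by (intro exI[of _ "\<lambda>z. B (p1 z) (p2 z)"] conjI) simp_all

lemma semidecE:
  assumes "semidec P"
  obtains B where "dec (\<lambda>z. B (p1 z) (p2 z))" "\<And>x. P x \<longleftrightarrow> (\<exists>y. B x y)"
proof -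
  obtain B where "dec B" "\<forall>x. P x \<longleftrightarrow> (\<exists>y. B (pr x y))"
    using assms unfolding semidec_def by blast
  then show ?thesis by (intro that[of "\<lambda>x y. B (pr x y)"]) simp_all
qed

lemma semidec_dec: "dec P \<Longrightarrow> semidec P"
  using semidecI[of "\<lambda>x y. P x"] dec_compose[of P p1] computable_p1[OF computable_id] by simp

lemma semidec_compose:
  assumes "semidec P" "computable F"
  shows "semidec (\<lambda>x. P (F x))"
proof -
  obtain B where B: "dec (\<lambda>z. B (p1 z) (p2 z))" "\<And>x. P x \<longleftrightarrow> (\<exists>y. B x y)"
    using assms(1) by (rule semidecE) (rule that)
  have "computable (\<lambda>z. pr (F (p1 z)) (p2 z))"
    by (intro computable_intros computable_compose[OF assms(2)])
  from dec_compose[OF B(1) this] show ?thesis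
    unfolding B(2) by (intro semidecI) simp
qed

lemma semidec_ex:
  assumes "semidec (\<lambda>z. P (p1 z) (p2 z))"
  shows "semidec (\<lambda>x. \<exists>y. P x y)"
proof -
  obtain B where B: "dec (\<lambda>z. B (p1 z) (p2 z))" "\<And>x. P (p1 x) (p2 x) \<longleftrightarrow> (\<exists>y. B x y)"
    using assms by (rule semidecE) (rule that)
  have P: "P x y \<longleftrightarrow> (\<exists>w. B (pr x y) w)" for x y using B(2)[of "pr x y"] by simp
  have eq: "(\<exists>y. P x y) \<longleftrightarrow> (\<exists>w. B (pr x (p1 w)) (p2 w))" for x
    unfolding P using pr_simps(1,2) by (intro iffI; elim exE) (rule exI[of _ "pr _ _"], simp, blast)
  have "computable (\<lambda>z. pr (pr (p1 z) (p1 (p2 z))) (p2 (p2 z)))"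
    by (intro computable_intros)
  from dec_compose[OF B(1) this] show ?thesis
    unfolding eq by (intro semidecI) simp
qed

lemma semidec_conj:
  assumes "semidec P" "semidec Q"
  shows "semidec (\<lambda>x. P x \<and> Q x)"
proof -
  obtain B where B: "dec (\<lambda>z. B (p1 z) (p2 z))" "\<And>x. P x \<longleftrightarrow> (\<exists>y. B x y)"
    using assms(1) by (rule semidecE) (rule that)
  obtain C where C: "dec (\<lambda>z. C (p1 z) (p2 z))" "\<And>x. Q x \<longleftrightarrow> (\<exists>y. C x y)"
    using assms(2) by (rule semidecE) (rule that)
  have eq: "P x \<and> Q x \<longleftrightarrow> (\<exists>w. B x (p1 w) \<and> C x (p2 w))" for x
    unfolding B(2) C(2)
    by (intro iffI; elim exE conjE) (rule exI[of _ "pr _ _"], simp, blast)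
  have c: "computable (\<lambda>z. pr (p1 z) (p1 (p2 z)))" "computable (\<lambda>z. pr (p1 z) (p2 (p2 z)))"
    by (intro computable_intros)+
  from dec_conj[OF dec_compose[OF B(1) c(1)] dec_compose[OF C(1) c(2)]] show ?thesis
    unfolding eq by (intro semidecI) simp
qed

lemma semidec_disj:
  assumes "semidec P" "semidec Q"
  shows "semidec (\<lambda>x. P x \<or> Q x)"
proof -
  obtain B where B: "dec (\<lambda>z. B (p1 z) (p2 z))" "\<And>x. P x \<longleftrightarrow> (\<exists>y. B x y)"
    using assms(1) by (rule semidecE) (rule that)
  obtain C where C: "dec (\<lambda>z. C (p1 z) (p2 z))" "\<And>x. Q x \<longleftrightarrow> (\<exists>y. C x y)"
    using assms(2) by (rule semidecE) (rule that)
  have eq: "P x \<or> Q x \<longleftrightarrow> (\<exists>w. B x w \<or> C x w)" for x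
    unfolding B(2) C(2) by blast
  show ?thesis
    unfolding eq by (intro semidecI dec_disj B C)
qed

text \<open>Finitely many witnesses have a common bound \<open>N\<close>, so the bounded universal
  quantifier can be moved inside an existential one.\<close>

lemma semidec_ball:
  assumes "semidec (\<lambda>z. P (p1 z) (p2 z))" "computable F"
  shows "semidec (\<lambda>x. \<forall>m<F x. P x m)"
proof -
  obtain B where B: "dec (\<lambda>z. B (p1 z) (p2 z))" "\<And>x. P (p1 x) (p2 x) \<longleftrightarrow> (\<exists>y. B x y)"
    using assms(1) by (rule semidecE) (rule that)
  have P: "P x y \<longleftrightarrow> (\<exists>w. B (pr x y) w)" for x y using B(2)[of "pr x y"] by simp
  have eq: "(\<forall>m<F x. P x m) \<longleftrightarrow> (\<exists>N. \<forall>m<F x. \<exists>w<N. B (pr x m) w)" for x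
  proof
    assume "\<forall>m<F x. P x m"
    then obtain w where w: "\<And>m. m < F x \<Longrightarrow> B (pr x m) (w m)" unfolding P by metis
    have "w m < Suc (Max (w ` {..<F x}))" if "m < F x" for m
      using that by (simp add: less_Suc_eq_le)
    with w show "\<exists>N. \<forall>m<F x. \<exists>w<N. B (pr x m) w" by blast
  qed (auto simp: P)
  have "computable (\<lambda>z. pr (pr (p1 (p1 (p1 z))) (p2 (p1 z))) (p2 z))"
    by (intro computable_intros)
  from dec_compose[OF B(1) this]
  have "dec (\<lambda>z. B (pr (p1 (p1 (p1 z))) (p2 (p1 z))) (p2 z))" by simp
  then show ?thesis
    unfolding eq by (intro semidecI dec_ball dec_bex computable_intros computable_compose[OF assms(2)])
qed

lemmas semidec_intros = semidec_ex semidec_conj semidec_disj semidec_ball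


section \<open>Inductive definitions with semidecidable rules\<close>

text \<open>Rules with one premise ignore the third argument of \<open>R2\<close>.\<close>

inductive clos :: "(nat \<Rightarrow> bool) \<Rightarrow> (nat \<Rightarrow> nat \<Rightarrow> nat \<Rightarrow> bool) \<Rightarrow> nat \<Rightarrow> bool"
  for R0 R2 where
  base: "R0 x \<Longrightarrow> clos R0 R2 x"
| step: "clos R0 R2 y \<Longrightarrow> clos R0 R2 z \<Longrightarrow> R2 x y z \<Longrightarrow> clos R0 R2 x"

definition derivation :: "(nat \<Rightarrow> bool) \<Rightarrow> (nat \<Rightarrow> nat \<Rightarrow> nat \<Rightarrow> bool) \<Rightarrow> (nat \<Rightarrow> nat) \<Rightarrow> nat \<Rightarrow> bool" where
  "derivation R0 R2 d n \<longleftrightarrow>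
     (\<forall>i<n. R0 (d i) \<or> (\<exists>j<i. \<exists>k<i. R2 (d i) (d j) (d k)))"

lemma derivation_sound:
  assumes "derivation R0 R2 d n" "i < n"
  shows "clos R0 R2 (d i)"
  using assms(2)
proof (induction i rule: less_induct)
  case (less i)
  then consider "R0 (d i)" | j k where "j < i" "k < i" "R2 (d i) (d j) (d k)"
    using assms(1) unfolding derivation_def by blast
  then show ?case
  proof cases
    case 1
    then show ?thesis by (rule clos.base)
  next
    case 2
    then have "clos R0 R2 (d j)" "clos R0 R2 (d k)" using less by simp_all
    then show ?thesis using 2(3) by (rule clos.step)
  qed
qed

lemma derivation_append:
  assumes "derivation R0 R2 d m" "derivation R0 R2 e n"
  shows "derivation R0 R2 (\<lambda>i. if i < m then d i else e (i - m)) (m + n)"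
  unfolding derivation_def
proof (intro allI impI)
  fix i assume "i < m + n"
  show "R0 (if i < m then d i else e (i - m)) \<or>
    (\<exists>j<i. \<exists>k<i. R2 (if i < m then d i else e (i - m))
       (if j < m then d j else e (j - m)) (if k < m then d k else e (k - m)))"
  proof (cases "i < m")
    case True
    then show ?thesis using assms(1) unfolding derivation_def by (smt (verit) order.strict_trans)
  next
    case False
    then have "i - m < n" using \<open>i < m + n\<close> by simp
    then consider "R0 (e (i - m))" | j k where "j < i - m" "k < i - m" "R2 (e (i - m)) (e j) (e k)"
      using assms(2) unfolding derivation_def by blast
    then show ?thesis
    proof cases
      case 2
      then have "m + j < i" "m + k < i" "\<not> m + j < m" "\<not> m + k < m" "m + j - m = j" "m + k - m = k"
        by simp_all
      with 2 False show ?thesis by metis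
    qed (use False in simp)
  qed
qed

lemma derivation_complete: "clos R0 R2 x \<Longrightarrow> \<exists>d n. derivation R0 R2 d (Suc n) \<and> d n = x"
proof (induction rule: clos.induct)
  case (base x)
  then show ?case
    by (intro exI[of _ "\<lambda>_. x"] exI[of _ 0]) (simp add: derivation_def)
next
  case (step y z x)
  then obtain d m e n where d: "derivation R0 R2 d (Suc m)" "d m = y"
    and e: "derivation R0 R2 e (Suc n)" "e n = z" by blast
  \<comment> \<open>The two derivations are concatenated and the new conclusion is put last; its
    premises sit at positions \<open>m\<close> and \<open>Suc m + n\<close>.\<close>
  define c where "c = (\<lambda>i. if i < Suc m then d i else e (i - Suc m))"
  define c' where "c' = c(Suc m + Suc n := x)"
  have c: "derivation R0 R2 c (Suc m + Suc n)" "c m = y" "c (Suc m + n) = z"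
    using derivation_append[OF d(1) e(1)] d(2) e(2) by (simp_all add: c_def)
  have "derivation R0 R2 c' (Suc (Suc m + Suc n))"
    unfolding derivation_def
  proof (intro allI impI)
    fix i assume "i < Suc (Suc m + Suc n)"
    then consider "i < Suc m + Suc n" | "i = Suc m + Suc n" by linarith
    then show "R0 (c' i) \<or> (\<exists>j<i. \<exists>k<i. R2 (c' i) (c' j) (c' k))"
    proof cases
      case 1
      moreover have "c' j = c j" if "j < Suc m + Suc n" for j
        using that by (simp add: c'_def)
      ultimately show ?thesis
        using c(1) unfolding derivation_def by (metis order.strict_trans)
    next
      case 2
      then have "m < i" "Suc m + n < i" "c' i = x" "c' m = y" "c' (Suc m + n) = z"
        using c(2,3) by (simp_all add: c'_def)
      then show ?thesis using step.hyps(3) by metis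
    qed
  qed
  moreover have "c' (Suc m + Suc n) = x" by (simp add: c'_def)
  ultimately show ?case by metis
qed

text \<open>A sequence is coded by nested pairs. No length is stored: every number codes an infinite
  sequence, and each finite sequence is an initial part of a coded one.\<close>

definition entry :: "nat \<Rightarrow> nat \<Rightarrow> nat" where
  "entry L i = p1 ((p2 ^^ i) L)"

lemma entry_exists: "\<exists>L. \<forall>i<n. entry L i = d i"
proof (induction n arbitrary: d)
  case (Suc n)
  obtain L where L: "\<forall>i<n. entry L i = d (Suc i)" using Suc.IH[of "\<lambda>i. d (Suc i)"] by blast
  have "entry (pr (d 0) L) i = d i" if "i < Suc n" for i
    using that L by (cases i) (simp_all add: entry_def funpow_swap1)
  then show ?case by blast
qed simp

lemma computable_entry:
  "computable F \<Longrightarrow> computable G \<Longrightarrow> computable (\<lambda>x. entry (F x) (G x))"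
  unfolding entry_def by (intro computable_funpow computable_intros)

text \<open>A derivation is finite, hence a number. The bounds on \<open>j\<close> and
  \<open>k\<close> are conjuncts under plain existential quantifiers, so that the closure rules for
  \<open>semidec\<close> apply literally.\<close>

lemma clos_iff:
  "clos R0 R2 x \<longleftrightarrow> (\<exists>L n. entry L n = x \<and>
     (\<forall>i<Suc n. R0 (entry L i) \<or> (\<exists>j k. j < i \<and> k < i \<and> R2 (entry L i) (entry L j) (entry L k))))"
proof
  assume "clos R0 R2 x"
  from derivation_complete[OF this]
  obtain d n where d: "derivation R0 R2 d (Suc n)" "d n = x" by (elim exE conjE)
  obtain L where L: "\<forall>i<Suc n. entry L i = d i" using entry_exists[of "Suc n" d] by blast
  have "R0 (entry L i) \<or> (\<exists>j k. j < i \<and> k < i \<and> R2 (entry L i) (entry L j) (entry L k))"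
    if i: "i < Suc n" for i
  proof -
    have eq: "entry L j = d j" if "j \<le> i" for j using that L i by simp
    consider "R0 (d i)" | j k where "j < i" "k < i" "R2 (d i) (d j) (d k)"
      using d(1) i unfolding derivation_def by blast
    then show ?thesis
    proof cases
      case 2
      then have "R2 (entry L i) (entry L j) (entry L k)" by (simp add: eq)
      with 2 show ?thesis by auto
    qed (simp add: eq)
  qed
  then show "\<exists>L n. entry L n = x \<and>
     (\<forall>i<Suc n. R0 (entry L i) \<or> (\<exists>j k. j < i \<and> k < i \<and> R2 (entry L i) (entry L j) (entry L k)))"
    using L d(2) by (intro exI[of _ L] exI[of _ n]) simp
next
  assume "\<exists>L n. entry L n = x \<and>
     (\<forall>i<Suc n. R0 (entry L i) \<or> (\<exists>j k. j < i \<and> k < i \<and> R2 (entry L i) (entry L j) (entry L k)))"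
  then obtain L n where Ln: "entry L n = x"
    "\<forall>i<Suc n. R0 (entry L i) \<or> (\<exists>j k. j < i \<and> k < i \<and> R2 (entry L i) (entry L j) (entry L k))"
    by (elim exE conjE)
  from Ln(2) have "derivation R0 R2 (entry L) (Suc n)"
    unfolding derivation_def by auto
  from derivation_sound[OF this, of n] Ln(1) show "clos R0 R2 x" by simp
qed

text \<open>The common source of enumerability below: evaluation of programs, the generated
  congruence, substitution, reachability and the configurations of terms are all instances.\<close>

lemma semidec_clos:
  assumes "semidec R0" "semidec (\<lambda>w. R2 (p1 w) (p1 (p2 w)) (p2 (p2 w)))"
  shows "semidec (\<lambda>x. clos R0 R2 x)"
proof -
  have R2: "semidec (\<lambda>x. R2 (F x) (G x) (H x))" if "computable F" "computable G" "computable H" for F G H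
    using semidec_compose[OF assms(2) computable_pr[OF that(1) computable_pr[OF that(2,3)]]]
    by simp
  show ?thesis
    unfolding clos_iff
    by (rule semidec_intros semidec_dec[OF dec_eq] semidec_dec[OF dec_less] R2 semidec_compose[OF assms(1)]
        computable_entry computable_intros)+
qed

section \<open>Domains of programs and the parametrization theorem\<close>

lemma semidec_domain:
  assumes "semidec P"
  obtains c where "\<And>x. eval c x \<noteq> None \<longleftrightarrow> P x"
proof -
  obtain B where B: "dec (\<lambda>z. B (p1 z) (p2 z))" "\<And>x. P x \<longleftrightarrow> (\<exists>y. B x y)"
    using assms by (rule semidecE) (rule that)
  \<comment> \<open>\<open>Mu\<close> searches for a zero, hence the negation; the program is total
    with values 0 and 1, so the search never gets stuck on an undefined value.\<close>
  obtain c where c: "\<And>z. eval c z = Some (if \<not> B (p1 z) (p2 z) then 1 else 0)"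
    using dec_not[OF B(1)] unfolding dec_computable computable_def by blast
  have c': "eval c (prod_encode (x, n)) = Some (if B x n then 0 else 1)" for x n
    using c[of "pr x n"] by (simp add: pr_def[symmetric])
  have "eval (Mu c) x \<noteq> None \<longleftrightarrow> P x" for x
  proof -
    have "(\<exists>n. B x n \<and> (\<forall>m<n. \<not> B x m)) \<longleftrightarrow> (\<exists>n. B x n)"
      using exists_least_iff[of "B x"] by blast
    then show ?thesis unfolding B(2) by (auto simp: c')
  qed
  then show ?thesis using that by blast
qed

text \<open>Parametrization plugs a number into a program, so programs for constants need computable
  indices. \<open>4 * pr 1 r + 5\<close> is the number of \<open>Comp Succ\<close> applied to the
  program numbered \<open>r\<close>.\<close>

lemma computable_code_encode_const:
  "\<exists>h. computable h \<and> (\<forall>n x. eval (code_decode (h n)) x = Some n)"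
proof -
  let ?S = "\<lambda>(_::nat) r. 4 * pr 1 r + 5"
  define h where "h n = rec_nat 0 (\<lambda>_ r. 4 * pr 1 r + 5) n" for n
  have "computable (\<lambda>n. rec_nat 0 ((\<lambda>_ _ r. 4 * pr 1 r + 5) n) n)"
    by (intro computable_rec_nat computable_intros)
  then have "computable h" by (simp add: h_def[abs_def])
  moreover have "\<exists>c. h n = code_encode c \<and> (\<forall>x. eval c x = Some n)" for n
  proof (induction n)
    case 0
    show ?case by (intro exI[of _ Zero]) (simp add: h_def)
  next
    case (Suc n)
    then obtain c where "h n = code_encode c" "\<forall>x. eval c x = Some n" by blast
    then show ?case by (intro exI[of _ "Comp Succ c"]) (simp add: h_def pr_def)
  qed
  then have "eval (code_decode (h n)) x = Some n" for n x
    by (metis code_decode_encode)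
  ultimately show ?thesis by blast
qed

lemma semidec_parametrization:
  assumes "semidec P"
  obtains h where "computable h" "\<And>x. W (h x) = {y. P (pr x y)}"
proof -
  obtain c where c: "\<And>x. eval c x \<noteq> None \<longleftrightarrow> P x" using semidec_domain[OF assms] by metis
  obtain k where k: "computable k" "\<And>n x. eval (code_decode (k n)) x = Some n"
    using computable_code_encode_const by blast
  \<comment> \<open>\<open>Pairing Fst Snd\<close> is the identity, so this numbers the program that
    sends \<open>y\<close> to the value of \<open>c\<close> at \<open>(x, y)\<close>.\<close>
  define h where "h x = 4 * pr (code_encode c) (4 * pr (k x) (code_encode (Pairing Fst Snd)) + 4) + 5" for x
  have h: "h x = code_encode (Comp c (Pairing (code_decode (k x)) (Pairing Fst Snd)))" for x
    by (simp add: h_def pr_def)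
  have "eval (code_decode (h x)) y = eval c (pr x y)" for x y
    unfolding h code_decode_encode by (simp add: k(2) pr_def)
  then have "W (h x) = {y. P (pr x y)}" for x
    unfolding W_def by (simp only: c)
  moreover have "computable h"
    unfolding h_def by (intro computable_intros k(1))
  ultimately show ?thesis using that by blast
qed

section \<open>The universal relation\<close>

text \<open>
  \<open>pos_below e x n\<close> codes the statement that program \<open>e\<close> is positive at \<open>(x, m)\<close> for all \<open>m < n\<close>; it
  turns unbounded search into rules with two premises.
\<close>

definition val_of :: "nat \<Rightarrow> nat \<Rightarrow> nat \<Rightarrow> nat" where
  "val_of e x y = pr 0 (pr e (pr x y))"

definition pos_below :: "nat \<Rightarrow> nat \<Rightarrow> nat \<Rightarrow> nat" where
  "pos_below e x n = pr 1 (pr e (pr x n))"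

lemma val_of_simps [simp]:
  "val_of e x y = val_of e' x' y' \<longleftrightarrow> e = e' \<and> x = x' \<and> y = y'"
  "pos_below e x y = pos_below e' x' y' \<longleftrightarrow> e = e' \<and> x = x' \<and> y = y'"
  "val_of e x y \<noteq> pos_below e' x' y'" "pos_below e x y \<noteq> val_of e' x' y'"
  by (simp_all add: val_of_def pos_below_def)

definition eval_base :: "nat \<Rightarrow> bool" where
  "eval_base z \<longleftrightarrow> (\<exists>x.
     z = val_of 0 x 0 \<or> z = val_of 1 x (Suc x) \<or> z = val_of 2 x (p1 x) \<or> z = val_of 3 x (p2 x) \<or>
     (\<exists>e. z = pos_below e x 0))"

text \<open>The clauses are, in order: pairing, composition, recursion at zero, recursion at a
  successor, one more positive value in a search, and a successful search. The additive constants 4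
  to 7 are those of \<open>code_encode\<close>.\<close>

definition eval_step :: "nat \<Rightarrow> nat \<Rightarrow> nat \<Rightarrow> bool" where
  "eval_step z a b \<longleftrightarrow> (\<exists>c d x u v.
     z = val_of (4 * pr c d + 4) x (pr u v) \<and> a = val_of c x u \<and> b = val_of d x v \<or>
     z = val_of (4 * pr c d + 5) x v \<and> a = val_of d x u \<and> b = val_of c u v \<or>
     z = val_of (4 * pr c d + 6) (pr x 0) v \<and> a = val_of c x v \<or>
     (\<exists>k. z = val_of (4 * pr c d + 6) (pr x (Suc k)) v \<and>
        a = val_of (4 * pr c d + 6) (pr x k) u \<and> b = val_of d (pr x (pr k u)) v) \<or>
     z = pos_below c x (Suc u) \<and> a = pos_below c x u \<and> b = val_of c (pr x u) (Suc v) \<or>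
     z = val_of (4 * c + 7) x u \<and> a = pos_below c x u \<and> b = val_of c (pr x u) 0)"

lemma eval_step_intros:
  "eval_step (val_of (4 * pr c d + 4) x (pr u v)) (val_of c x u) (val_of d x v)"
  "eval_step (val_of (4 * pr c d + 5) x v) (val_of d x u) (val_of c u v)"
  "eval_step (val_of (4 * pr c d + 6) (pr x 0) v) (val_of c x v) b"
  "eval_step (val_of (4 * pr c d + 6) (pr x (Suc k)) v)
     (val_of (4 * pr c d + 6) (pr x k) u) (val_of d (pr x (pr k u)) v)"
  "eval_step (pos_below c x (Suc u)) (pos_below c x u) (val_of c (pr x u) (Suc v))"
  "eval_step (val_of (4 * c + 7) x u) (pos_below c x u) (val_of c (pr x u) 0)"
  unfolding eval_step_def by blast+

lemma semidec_eval_clos: "semidec (\<lambda>z. clos eval_base eval_step z)"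
  unfolding val_of_def pos_below_def eval_base_def eval_step_def
  by (rule semidec_clos semidec_intros semidec_dec[OF dec_eq] computable_intros)+

lemma code_decode_simps:
  "code_decode 0 = Zero" "code_decode 1 = Succ" "code_decode 2 = Fst" "code_decode 3 = Snd"
  "code_decode (4 * pr c d + 4) = Pairing (code_decode c) (code_decode d)"
  "code_decode (4 * pr c d + 5) = Comp (code_decode c) (code_decode d)"
  "code_decode (4 * pr c d + 6) = Prec (code_decode c) (code_decode d)"
  "code_decode (4 * c + 7) = Mu (code_decode c)"
  by (rule injD[OF inj_code_encode]; simp add: pr_def)+

lemma eval_pr_simps:
  "eval (Prec c d) (pr x 0) = eval c x"
  "eval (Prec c d) (pr x (Suc k)) =
     Option.bind (eval (Prec c d) (pr x k)) (\<lambda>r. eval d (pr x (pr k r)))"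
  by (simp_all add: pr_def)

lemma eval_Mu_iff:
  "eval (Mu c) x = Some n \<longleftrightarrow> eval c (pr x n) = Some 0 \<and> (\<forall>m<n. \<exists>y. eval c (pr x m) = Some (Suc y))"
proof -
  define Q where "Q n \<longleftrightarrow> eval c (pr x n) = Some 0 \<and> (\<forall>m<n. \<exists>y. eval c (pr x m) = Some (Suc y))" for n
  have ev: "eval (Mu c) x = (if \<exists>n. Q n then Some (LEAST n. eval c (pr x n) = Some 0) else None)"
    by (simp add: Q_def pr_def)
  have "(LEAST n. eval c (pr x n) = Some 0) = n" if "Q n" for n
  proof (rule Least_equality)
    show "eval c (pr x n) = Some 0" using that by (simp add: Q_def)
    show "n \<le> m" if "eval c (pr x m) = Some 0" for m
      using \<open>Q n\<close> that unfolding Q_def by (metis not_le option.inject nat.distinct(1))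
  qed
  then show ?thesis unfolding ev Q_def[symmetric] by auto
qed

text \<open>The soundness induction runs over bare numbers, so the invariant is a predicate of
  numbers, vacuous for those that code no statement.\<close>

definition eval_meaning :: "nat \<Rightarrow> bool" where
  "eval_meaning z \<longleftrightarrow>
     (\<forall>e x y. z = val_of e x y \<longrightarrow> eval (code_decode e) x = Some y) \<and>
     (\<forall>e x n. z = pos_below e x n \<longrightarrow> (\<forall>m<n. \<exists>y. eval (code_decode e) (pr x m) = Some (Suc y)))"

lemma eval_meaning_simps [simp]:
  "eval_meaning (val_of e x y) \<longleftrightarrow> eval (code_decode e) x = Some y"
  "eval_meaning (pos_below e x n) \<longleftrightarrow> (\<forall>m<n. \<exists>y. eval (code_decode e) (pr x m) = Some (Suc y))"
  by (auto simp: eval_meaning_def)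

lemma eval_clos_sound: "clos eval_base eval_step z \<Longrightarrow> eval_meaning z"
proof (induction rule: clos.induct)
  case (base z)
  then show ?case
    unfolding eval_base_def by (elim exE disjE) (simp_all add: code_decode_simps p1_def p2_def del: One_nat_def)
next
  case (step a b z)
  from step.hyps(3) show ?case
    unfolding eval_step_def
  proof (elim exE disjE conjE)
    fix c d x u v
    assume "z = val_of (4 * pr c d + 4) x (pr u v)" "a = val_of c x u" "b = val_of d x v"
    with step.IH show ?thesis by (simp add: code_decode_simps) (simp add: pr_def)
  next
    fix c d x u v
    assume "z = val_of (4 * pr c d + 5) x v" "a = val_of d x u" "b = val_of c u v"
    with step.IH show ?thesis by (simp add: code_decode_simps)
  next
    fix c d x u v :: nat
    assume "z = val_of (4 * pr c d + 6) (pr x 0) v" "a = val_of c x v"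
    with step.IH show ?thesis by (simp add: code_decode_simps eval_pr_simps del: eval.simps)
  next
    fix c d x u v k
    assume "z = val_of (4 * pr c d + 6) (pr x (Suc k)) v"
      "a = val_of (4 * pr c d + 6) (pr x k) u" "b = val_of d (pr x (pr k u)) v"
    with step.IH show ?thesis by (simp add: code_decode_simps eval_pr_simps del: eval.simps)
  next
    fix c d x u v :: nat
    assume "z = pos_below c x (Suc u)" "a = pos_below c x u" "b = val_of c (pr x u) (Suc v)"
    with step.IH show ?thesis by (auto simp: less_Suc_eq)
  next
    fix c d x u v :: nat
    assume "z = val_of (4 * c + 7) x u" "a = pos_below c x u" "b = val_of c (pr x u) 0"
    with step.IH show ?thesis by (simp add: code_decode_simps eval_Mu_iff del: eval.simps)
  qed
qed

abbreviation "eval_clos \<equiv> clos eval_base eval_step"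

lemma eval_clos_complete: "eval c x = Some y \<Longrightarrow> eval_clos (val_of (code_encode c) x y)"
proof (induction c arbitrary: x y)
  case Zero
  then show ?case by (intro clos.base) (auto simp: eval_base_def)
next
  case Succ
  then show ?case by (intro clos.base) (auto simp: eval_base_def)
next
  case Fst
  then show ?case by (intro clos.base) (auto simp: eval_base_def p1_def)
next
  case Snd
  then show ?case by (intro clos.base) (auto simp: eval_base_def p2_def)
next
  case (Pairing c d)
  then obtain u v where "eval c x = Some u" "eval d x = Some v" "y = pr u v"
    by (auto simp: bind_eq_Some_conv pr_def)
  with Pairing.IH have "eval_clos (val_of (code_encode c) x u)" "eval_clos (val_of (code_encode d) x v)"
    by blast+
  then show ?case
    using eval_step_intros(1) unfolding \<open>y = pr u v\<close> code_encode.simps pr_def[symmetric]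
    by (rule clos.step)
next
  case (Comp c d)
  then obtain u where "eval d x = Some u" "eval c u = Some y"
    by (auto simp: bind_eq_Some_conv)
  with Comp.IH have "eval_clos (val_of (code_encode d) x u)" "eval_clos (val_of (code_encode c) u y)"
    by blast+
  then show ?case
    using eval_step_intros(2) unfolding code_encode.simps pr_def[symmetric]
    by (rule clos.step)
next
  case (Prec c d)
  \<comment> \<open>The program stays fixed while the recursion unwinds, so an inner induction on
    the number of rounds is needed.\<close>
  have "eval_clos (val_of (code_encode (Prec c d)) (pr a k) v)" if "eval (Prec c d) (pr a k) = Some v" for a k v
    using that
  proof (induction k arbitrary: v)
    case 0
    then have "eval c a = Some v" by (simp add: eval_pr_simps del: eval.simps)
    then have "eval_clos (val_of (code_encode c) a v)" by (rule Prec.IH)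
    from clos.step[OF this this eval_step_intros(3)] show ?case
      by (simp only: code_encode.simps pr_def[symmetric])
  next
    case (Suc k)
    then obtain u where u: "eval (Prec c d) (pr a k) = Some u" "eval d (pr a (pr k u)) = Some v"
      by (auto simp: eval_pr_simps bind_eq_Some_conv simp del: eval.simps)
    from clos.step[OF Suc.IH[OF u(1), unfolded code_encode.simps pr_def[symmetric]]
        Prec.IH(2)[OF u(2)] eval_step_intros(4)]
    show ?case
      by (simp only: code_encode.simps pr_def[symmetric])
  qed
  from this[of "p1 x" "p2 x" y] Prec.prems show ?case by (simp del: eval.simps code_encode.simps)
next
  case (Mu c)
  then have c: "eval c (pr x y) = Some 0" "\<forall>m<y. \<exists>v. eval c (pr x m) = Some (Suc v)"
    by (simp_all add: eval_Mu_iff del: eval.simps)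
  have "eval_clos (pos_below (code_encode c) x n)" if "n \<le> y" for n
    using that
  proof (induction n)
    case 0
    show ?case by (rule clos.base) (auto simp: eval_base_def)
  next
    case (Suc n)
    then have "n < y" by simp
    with c(2) obtain v where "eval c (pr x n) = Some (Suc v)" by blast
    from clos.step[OF Suc.IH Mu.IH[OF this] eval_step_intros(5)] Suc.prems show ?case
      by simp
  qed
  from clos.step[OF this[OF order_refl] Mu.IH[OF c(1)] eval_step_intros(6)] show ?case
    by (simp only: code_encode.simps)
qed

lemma W_iff: "x \<in> W e \<longleftrightarrow> (\<exists>y. eval_clos (val_of e x y))"
proof
  assume "x \<in> W e"
  then obtain y where "eval (code_decode e) x = Some y" by (auto simp: W_def)
  from eval_clos_complete[OF this] show "\<exists>y. eval_clos (val_of e x y)" by auto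
next
  assume "\<exists>y. eval_clos (val_of e x y)"
  then show "x \<in> W e" using eval_clos_sound by (fastforce simp: W_def)
qed

text \<open>The index may vary with the argument: membership is c.e. uniformly in the index, which
  the congruence rules rely on.\<close>

lemma semidec_W:
  assumes "computable F" "computable G"
  shows "semidec (\<lambda>z. F z \<in> W (G z))"
  unfolding W_iff
  by (rule semidec_ex, rule semidec_compose[OF semidec_eval_clos])
    (unfold val_of_def, intro computable_intros computable_compose[OF assms(1)] computable_compose[OF assms(2)])

section \<open>Isomorphism of presented algebras\<close>

text \<open>The generated congruence described from below: derivations can be enumerated, unlike the
  intersection in its definition.\<close>

inductive tcong :: "(trm \<times> trm) set \<Rightarrow> trm \<Rightarrow> trm \<Rightarrow> bool" for S where
  rel: "(s, t) \<in> S \<Longrightarrow> tcong S s t"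
| refl: "tcong S s s"
| sym: "tcong S s t \<Longrightarrow> tcong S t s"
| trans: "tcong S s t \<Longrightarrow> tcong S t u \<Longrightarrow> tcong S s u"
| cong_f: "tcong S s t \<Longrightarrow> tcong S (Ap_f s) (Ap_f t)"
| cong_g: "tcong S s t \<Longrightarrow> tcong S (Ap_g s) (Ap_g t)"

lemma congruence_tcong: "congruence term_alg {(s, t). tcong S s t}"
proof -
  have "equiv UNIV {(s, t). tcong S s t}"
  proof (rule equivI)
    show "refl {(s, t). tcong S s t}" by (intro refl_onI) (simp add: tcong.refl)
    show "sym {(s, t). tcong S s t}" by (intro symI) (simp, erule tcong.sym)
    show "trans {(s, t). tcong S s t}" by (intro transI) (simp, erule (1) tcong.trans)
  qed simp
  then show ?thesis
    by (simp add: congruence_def term_alg_def tcong.cong_f tcong.cong_g)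
qed

lemma tcong_in_congruence:
  assumes "tcong S s t" "congruence term_alg \<theta>" "S \<subseteq> \<theta>"
  shows "(s, t) \<in> \<theta>"
proof -
  have e: "equiv UNIV \<theta>" and c: "\<forall>(s, t)\<in>\<theta>. (Ap_f s, Ap_f t) \<in> \<theta> \<and> (Ap_g s, Ap_g t) \<in> \<theta>"
    using assms(2) by (simp_all add: congruence_def term_alg_def)
  show ?thesis
    using assms(1)
  proof (induction rule: tcong.induct)
    case (rel s t)
    with assms(3) show ?case by blast
  next
    case (refl s)
    show ?case using e by (simp add: equiv_def refl_on_def)
  next
    case (sym s t)
    with e show ?case by (meson equivE symD)
  next
    case (trans s t u)
    with e show ?case by (meson equivE transD)
  next
    case (cong_f s t)
    with c show ?case by blast
  next
    case (cong_g s t)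
    with c show ?case by blast
  qed
qed

lemma generated_congruence_iff:
  "(s, t) \<in> generated_congruence term_alg S \<longleftrightarrow> tcong S s t"
proof
  assume "(s, t) \<in> generated_congruence term_alg S"
  moreover have "congruence term_alg {(s, t). tcong S s t}" by (rule congruence_tcong)
  moreover have "S \<subseteq> {(s, t). tcong S s t}" by (auto intro: tcong.rel)
  ultimately show "tcong S s t" unfolding generated_congruence_def by blast
next
  assume "tcong S s t"
  then show "(s, t) \<in> generated_congruence term_alg S"
    unfolding generated_congruence_def using tcong_in_congruence by blast
qed

definition term_eq :: "nat \<Rightarrow> trm \<Rightarrow> trm \<Rightarrow> bool" where
  "term_eq e = tcong {p. pair_encode p \<in> W e}"

lemma term_eq_intros:
  "term_eq e s s" "term_eq e s t \<Longrightarrow> term_eq e t s" "term_eq e s t \<Longrightarrow> term_eq e t u \<Longrightarrow> term_eq e s u"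
  "term_eq e s t \<Longrightarrow> term_eq e (Ap_f s) (Ap_f t)" "term_eq e s t \<Longrightarrow> term_eq e (Ap_g s) (Ap_g t)"
  unfolding term_eq_def by (fact tcong.refl tcong.sym tcong.trans tcong.cong_f tcong.cong_g)+

definition term_class :: "nat \<Rightarrow> trm \<Rightarrow> trm set" where
  "term_class e s = {t. term_eq e s t}"

lemma term_class_eq_iff: "term_class e s = term_class e t \<longleftrightarrow> term_eq e s t"
  unfolding term_class_def set_eq_iff mem_Collect_eq by (meson term_eq_intros(1-3))

lemma UF2_1_simps:
  "carrier (UF2_1 e) = range (term_class e)"
  "fop (UF2_1 e) (term_class e s) = term_class e (Ap_f s)"
  "gop (UF2_1 e) (term_class e s) = term_class e (Ap_g s)"
proof -
  let ?T = "generated_congruence term_alg {p. pair_encode p \<in> W e}"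
  have T: "?T `` {s} = term_class e s" for s
    by (auto simp: term_class_def term_eq_def generated_congruence_iff)
  have U: "carrier term_alg = UNIV" "fop term_alg = Ap_f" "gop term_alg = Ap_g"
    by (simp_all add: term_alg_def)
  have c: "congruence term_alg ?T"
    by (rule congruence_generated_congruence) (simp_all add: UF2_def U)
  show "carrier (UF2_1 e) = range (term_class e)"
    by (auto simp: UF2_1_def quotient_alg_def quotient_def T U)
  show "fop (UF2_1 e) (term_class e s) = term_class e (Ap_f s)" "gop (UF2_1 e) (term_class e s) = term_class e (Ap_g s)"
    using quotient_alg_class[OF c, of s] by (simp_all add: UF2_1_def T U)
qed

section \<open>Homomorphisms as substitutions\<close>

primrec subst :: "trm \<Rightarrow> trm \<Rightarrow> trm" where
  "subst u Gen = u"
| "subst u (Ap_f t) = Ap_f (subst u t)"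
| "subst u (Ap_g t) = Ap_g (subst u t)"

lemma subst_Gen [simp]: "subst Gen t = t"
  by (induction t) simp_all

lemma subst_subst: "subst u (subst v t) = subst (subst u v) t"
  by (induction t) simp_all

lemma term_eq_subst_left: "term_eq e u v \<Longrightarrow> term_eq e (subst u t) (subst v t)"
  by (induction t) (auto intro: term_eq_intros)

text \<open>A homomorphism from a 1-generated algebra is substitution of the image \<open>u\<close>
  of the generator. The biconditional makes it well defined and injective; it is onto as soon as the
  generator is reached, by \<open>v\<close>.\<close>

lemma iso_UF2_1_iff:
  "iso_UF2_1 e i \<longleftrightarrow>
     (\<exists>u v. term_eq i (subst u v) Gen \<and> (\<forall>s t. term_eq e s t \<longleftrightarrow> term_eq i (subst u s) (subst u t)))"
proof
  assume "iso_UF2_1 e i"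
  then obtain h where bij: "bij_betw h (range (term_class e)) (range (term_class i))"
    and hom: "\<forall>x\<in>range (term_class e).
      h (fop (UF2_1 e) x) = fop (UF2_1 i) (h x) \<and> h (gop (UF2_1 e) x) = gop (UF2_1 i) (h x)"
    unfolding iso_UF2_1_def isomorphic_def UF2_1_simps(1) by (elim exE conjE)
  have h: "h (term_class e (Ap_f s)) = fop (UF2_1 i) (h (term_class e s))"
    "h (term_class e (Ap_g s)) = gop (UF2_1 i) (h (term_class e s))" for s
    using bspec[OF hom rangeI[of "term_class e" s]] by (simp_all add: UF2_1_simps)
  obtain u where u: "h (term_class e Gen) = term_class i u"
    using bij_betw_apply[OF bij, of "term_class e Gen"] by blast
  have hs: "h (term_class e s) = term_class i (subst u s)" for s
    by (induction s) (simp_all add: u h UF2_1_simps)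
  have "term_class i Gen \<in> h ` range (term_class e)"
    using bij by (simp add: bij_betw_def)
  then obtain v where "h (term_class e v) = term_class i Gen" by force
  then have "term_eq i (subst u v) Gen" by (simp add: hs term_class_eq_iff)
  moreover have "term_eq e s t \<longleftrightarrow> term_eq i (subst u s) (subst u t)" for s t
    using inj_on_eq_iff[OF bij_betw_imp_inj_on[OF bij] rangeI[of "term_class e" s] rangeI[of "term_class e" t]]
    by (simp add: hs term_class_eq_iff)
  ultimately show "\<exists>u v. term_eq i (subst u v) Gen \<and> (\<forall>s t. term_eq e s t \<longleftrightarrow> term_eq i (subst u s) (subst u t))"
    by blast
next
  assume "\<exists>u v. term_eq i (subst u v) Gen \<and> (\<forall>s t. term_eq e s t \<longleftrightarrow> term_eq i (subst u s) (subst u t))"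
  then obtain u v where uv: "term_eq i (subst u v) Gen"
    and iff: "\<And>s t. term_eq e s t \<longleftrightarrow> term_eq i (subst u s) (subst u t)" by blast
  \<comment> \<open>By \<open>iff\<close> the choice of the representative does not matter.\<close>
  define h where "h X = term_class i (subst u (SOME s. X = term_class e s))" for X
  have h: "h (term_class e s) = term_class i (subst u s)" for s
  proof -
    have "term_class e s = term_class e (SOME t. term_class e s = term_class e t)" by (rule someI) simp
    then show ?thesis by (simp add: h_def term_class_eq_iff iff[symmetric] term_eq_intros(2))
  qed
  \<comment> \<open>Surjectivity: since \<open>u[v]\<close> equals the generator,
    \<open>v[t]\<close> is sent to the class of \<open>t\<close>.\<close>
  have "h (term_class e (subst v t)) = term_class i t" for t
    using term_eq_subst_left[OF uv, of t] by (simp add: h term_class_eq_iff subst_subst)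
  then have "range (term_class i) \<subseteq> h ` range (term_class e)" by (metis image_subsetI rangeI image_eqI)
  moreover have "h ` range (term_class e) \<subseteq> range (term_class i)" using h by auto
  moreover have "inj_on h (range (term_class e))"
    unfolding inj_on_def by (auto simp: h term_class_eq_iff iff)
  ultimately have "bij_betw h (range (term_class e)) (range (term_class i))"
    unfolding bij_betw_def by blast
  then show "iso_UF2_1 e i"
    unfolding iso_UF2_1_def isomorphic_def UF2_1_simps(1)
    by (intro exI[of _ h]) (auto simp: h UF2_1_simps)
qed

section \<open>Isomorphism as an equivalence relation\<close>

lemma isomorphic_refl: "isomorphic A A"
  unfolding isomorphic_def by (intro exI[of _ id]) simp

text \<open>Membership in \<open>UF2\<close> keeps \<open>fop A x\<close> and \<open>gop A x\<close>
  in the carrier, where the inverse of \<open>h\<close> is controlled.\<close>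

lemma isomorphic_sym:
  assumes "A \<in> UF2" "isomorphic A B"
  shows "isomorphic B A"
proof -
  obtain h where bij: "bij_betw h (carrier A) (carrier B)"
    and hom: "\<forall>x\<in>carrier A. h (fop A x) = fop B (h x) \<and> h (gop A x) = gop B (h x)"
    using assms(2) unfolding isomorphic_def by (elim exE conjE)
  let ?k = "the_inv_into (carrier A) h"
  have k: "?k (h z) = z" if "z \<in> carrier A" for z
    using that bij by (simp add: bij_betw_def the_inv_into_f_f)
  have "?k (fop B y) = fop A (?k y) \<and> ?k (gop B y) = gop A (?k y)" if y: "y \<in> carrier B" for y
  proof -
    have "y \<in> h ` carrier A" using y bij by (simp add: bij_betw_def)
    then obtain x where x: "x \<in> carrier A" "y = h x" by (rule imageE) (rule that)
    have A: "fop A x \<in> carrier A" "gop A x \<in> carrier A"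
      using assms(1) x(1) by (auto simp: UF2_def)
    have "fop B y = h (fop A x)" "gop B y = h (gop A x)"
      using bspec[OF hom x(1)] x(2) by simp_all
    then show ?thesis using k[OF A(1)] k[OF A(2)] k[OF x(1)] x(2) by simp
  qed
  then show ?thesis
    unfolding isomorphic_def using bij_betw_the_inv_into[OF bij] by (intro exI[of _ ?k] conjI ballI) simp_all
qed

lemma isomorphic_trans:
  assumes "isomorphic A B" "isomorphic B C"
  shows "isomorphic A C"
proof -
  obtain h where h: "bij_betw h (carrier A) (carrier B)"
    "\<forall>x\<in>carrier A. h (fop A x) = fop B (h x) \<and> h (gop A x) = gop B (h x)"
    using assms(1) unfolding isomorphic_def by (elim exE conjE)
  obtain k where k: "bij_betw k (carrier B) (carrier C)"
    "\<forall>x\<in>carrier B. k (fop B x) = fop C (k x) \<and> k (gop B x) = gop C (k x)"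
    using assms(2) unfolding isomorphic_def by (elim exE conjE)
  have "(k \<circ> h) (fop A x) = fop C ((k \<circ> h) x) \<and> (k \<circ> h) (gop A x) = gop C ((k \<circ> h) x)"
    if "x \<in> carrier A" for x
    using bspec[OF h(2) that] bspec[OF k(2) bij_betw_apply[OF h(1) that]] by simp
  then show ?thesis
    unfolding isomorphic_def
    using bij_betw_trans[OF h(1) k(1)] by (intro exI[of _ "k \<circ> h"] conjI ballI) simp_all
qed

lemma equivp_iso_UF2_1: "equivp iso_UF2_1"
proof (rule equivpI)
  show "reflp iso_UF2_1"
    by (simp add: reflp_def iso_UF2_1_def isomorphic_refl)
  show "symp iso_UF2_1"
    unfolding symp_def iso_UF2_1_def by (simp add: isomorphic_sym[OF UF2_1_in_UF2])
  show "transp iso_UF2_1"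
    unfolding transp_def iso_UF2_1_def by (intro allI impI) (rule isomorphic_trans)
qed


section \<open>The isomorphism relation is arithmetical of level three\<close>

definition trm_decode :: "nat \<Rightarrow> trm" where "trm_decode = inv trm_encode"

lemma trm_decode_enc [simp]: "trm_decode (trm_encode t) = t" "trm_encode (trm_decode n) = n"
  using bij_trm_encode by (simp_all add: trm_decode_def bij_is_inj bij_is_surj surj_f_inv_f)

lemma trm_decode_simps:
  "trm_decode 0 = Gen" "trm_decode (2 * n + 1) = Ap_f (trm_decode n)" "trm_decode (2 * n + 2) = Ap_g (trm_decode n)"
  using trm_decode_enc(1)[of Gen] trm_decode_enc(1)[of "Ap_f (trm_decode n)"] trm_decode_enc(1)[of "Ap_g (trm_decode n)"]
  by (simp_all only: trm_encode.simps trm_decode_enc(2))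

text \<open>Statements have the form \<open>pr e (pr s t)\<close>; carrying \<open>e\<close> along
  makes equality of terms c.e. uniformly in the index.\<close>

definition cong_base :: "nat \<Rightarrow> bool" where
  "cong_base z \<longleftrightarrow> p1 (p2 z) = p2 (p2 z) \<or> p2 z \<in> W (p1 z)"

definition cong_step :: "nat \<Rightarrow> nat \<Rightarrow> nat \<Rightarrow> bool" where
  "cong_step z a b \<longleftrightarrow> (\<exists>e s t u.
     z = pr e (pr s t) \<and> a = pr e (pr t s) \<or>
     z = pr e (pr s u) \<and> a = pr e (pr s t) \<and> b = pr e (pr t u) \<or>
     z = pr e (pr (2 * s + 1) (2 * t + 1)) \<and> a = pr e (pr s t) \<or>
     z = pr e (pr (2 * s + 2) (2 * t + 2)) \<and> a = pr e (pr s t))"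

lemma cong_step_intros:
  "cong_step (pr e (pr s t)) (pr e (pr t s)) b"
  "cong_step (pr e (pr s u)) (pr e (pr s t)) (pr e (pr t u))"
  "cong_step (pr e (pr (2 * s + 1) (2 * t + 1))) (pr e (pr s t)) b"
  "cong_step (pr e (pr (2 * s + 2) (2 * t + 2))) (pr e (pr s t)) b"
  unfolding cong_step_def by blast+

lemma term_eq_iff_clos: "term_eq e s t \<longleftrightarrow> clos cong_base cong_step (pr e (pr (trm_encode s) (trm_encode t)))"
proof
  assume "term_eq e s t"
  then show "clos cong_base cong_step (pr e (pr (trm_encode s) (trm_encode t)))"
    unfolding term_eq_def
  proof (induction rule: tcong.induct)
    case (rel s t)
    then show ?case by (intro clos.base) (simp add: cong_base_def pair_encode_def pr_def[symmetric])
  next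
    case (refl s)
    show ?case by (intro clos.base) (simp add: cong_base_def)
  next
    case (sym s t)
    show ?case by (rule clos.step[OF sym.IH sym.IH cong_step_intros(1)])
  next
    case (trans s t u)
    show ?case by (rule clos.step[OF trans.IH cong_step_intros(2)])
  next
    case (cong_f s t)
    show ?case unfolding trm_encode.simps by (rule clos.step[OF cong_f.IH cong_f.IH cong_step_intros(3)])
  next
    case (cong_g s t)
    show ?case unfolding trm_encode.simps by (rule clos.step[OF cong_g.IH cong_g.IH cong_step_intros(4)])
  qed
next
  have "term_eq (p1 z) (trm_decode (p1 (p2 z))) (trm_decode (p2 (p2 z)))" if "clos cong_base cong_step z" for z
    using that
  proof (induction rule: clos.induct)
    case (base z)
    then consider "p1 (p2 z) = p2 (p2 z)" | "p2 z \<in> W (p1 z)" by (auto simp: cong_base_def)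
    then show ?case
    proof cases
      case 1
      then show ?thesis by (simp add: term_eq_intros(1))
    next
      case 2
      then show ?thesis
        unfolding term_eq_def by (intro tcong.rel) (simp add: pair_encode_def pr_def[symmetric])
    qed
  next
    case (step a b z)
    from step.hyps(3) show ?case
      unfolding cong_step_def
      by (elim exE disjE conjE) (use step.IH in \<open>auto simp only: pr_simps trm_decode_simps intro: term_eq_intros\<close>)
  qed
  from this[of "pr e (pr (trm_encode s) (trm_encode t))"]
  show "clos cong_base cong_step (pr e (pr (trm_encode s) (trm_encode t))) \<Longrightarrow> term_eq e s t" by simp
qed

lemma semidec_th:
  assumes "computable F" "computable G" "computable H"
  shows "semidec (\<lambda>x. term_eq (F x) (trm_decode (G x)) (trm_decode (H x)))"
proof -
  have "semidec (\<lambda>z. clos cong_base cong_step z)"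
    unfolding cong_base_def cong_step_def
    by (rule semidec_clos semidec_intros semidec_dec[OF dec_eq] semidec_W computable_intros)+
  from semidec_compose[OF this computable_pr[OF assms(1) computable_pr[OF assms(2,3)]]]
  show ?thesis unfolding term_eq_iff_clos by simp
qed

section \<open>Computability of substitution\<close>

lemma computable_graph:
  assumes "semidec (\<lambda>z. p2 z = f (p1 z))"
  shows "computable f"
proof -
  obtain B where B: "dec (\<lambda>z. B (p1 z) (p2 z))" "\<And>z. p2 z = f (p1 z) \<longleftrightarrow> (\<exists>w. B z w)"
    using assms by (rule semidecE) (rule that)
  \<comment> \<open>A total function with c.e. graph is computable: search for a pair of a value and
    a witness, then project to the value.\<close>
  define Q where "Q x n \<longleftrightarrow> B (pr x (p1 n)) (p2 n)" for x n
  have Q_imp: "p1 n = f x" if "Q x n" for x n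
    using B(2)[of "pr x (p1 n)"] that unfolding Q_def pr_simps by blast
  have Q_ex: "\<exists>n. Q x n" for x
  proof -
    have "\<exists>w. B (pr x (f x)) w" using B(2)[of "pr x (f x)"] unfolding pr_simps by blast
    then obtain w where "B (pr x (f x)) w" by (rule exE)
    then have "Q x (pr (f x) w)" unfolding Q_def pr_simps .
    then show ?thesis by (rule exI)
  qed
  have "computable (\<lambda>z. pr (pr (p1 z) (p1 (p2 z))) (p2 (p2 z)))"
    by (intro computable_intros)
  from dec_not[OF dec_compose[OF B(1) this]] have "dec (\<lambda>z. \<not> Q (p1 z) (p2 z))"
    unfolding Q_def pr_simps .
  then obtain c where "\<And>z. eval c z = Some (if \<not> Q (p1 z) (p2 z) then 1 else 0)"
    unfolding dec_computable computable_def by blast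
  from this[of "pr _ _"] have c: "eval c (pr x n) = Some (if Q x n then 0 else 1)" for x n
    by simp
  have "eval (Comp Fst (Mu c)) x = Some (f x)" for x
  proof -
    obtain n where n: "Q x n" "\<forall>m<n. \<not> Q x m"
      using Q_ex[of x] exists_least_iff[of "Q x"] by blast
    then have "eval (Mu c) x = Some n" unfolding eval_Mu_iff c by simp
    then have "eval (Comp Fst (Mu c)) x = Some (p1 n)"
      unfolding p1_def by (simp only: eval.simps(3,6) bind.simps)
    then show ?thesis unfolding Q_imp[OF n(1)] .
  qed
  then show ?thesis unfolding computable_def by (intro exI[of _ "Comp Fst (Mu c)"] allI)
qed

text \<open>Substitution recurses on subterms, that is on roughly halved codes, while
  \<open>Prec\<close> recurses on predecessors. Its graph is therefore generated by rules, and
  \<open>computable_graph\<close> is applied.\<close>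

definition subst_step :: "nat \<Rightarrow> nat \<Rightarrow> nat \<Rightarrow> bool" where
  "subst_step z a b \<longleftrightarrow> (\<exists>u s r. a = pr (pr u s) r \<and>
     (z = pr (pr u (2 * s + 1)) (2 * r + 1) \<or> z = pr (pr u (2 * s + 2)) (2 * r + 2)))"

lemma subst_step_intros:
  "subst_step (pr (pr u (2 * s + 1)) (2 * r + 1)) (pr (pr u s) r) b"
  "subst_step (pr (pr u (2 * s + 2)) (2 * r + 2)) (pr (pr u s) r) b"
  unfolding subst_step_def by blast+

lemma subst_iff_clos:
  "r = trm_encode (subst (trm_decode u) s) \<longleftrightarrow> clos (\<lambda>z. \<exists>u. z = pr (pr u 0) u) subst_step (pr (pr u (trm_encode s)) r)"
    (is "_ \<longleftrightarrow> clos ?B _ _")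
proof
  have "clos ?B subst_step (pr (pr u (trm_encode s)) (trm_encode (subst (trm_decode u) s)))"
  proof (induction s)
    case Gen
    show ?case by (rule clos.base) simp
  next
    case (Ap_f s)
    show ?case unfolding trm_encode.simps subst.simps
      by (rule clos.step[OF Ap_f.IH Ap_f.IH subst_step_intros(1)])
  next
    case (Ap_g s)
    show ?case unfolding trm_encode.simps subst.simps
      by (rule clos.step[OF Ap_g.IH Ap_g.IH subst_step_intros(2)])
  qed
  then show "r = trm_encode (subst (trm_decode u) s) \<Longrightarrow> clos ?B subst_step (pr (pr u (trm_encode s)) r)" by simp
next
  have "trm_decode (p2 z) = subst (trm_decode (p1 (p1 z))) (trm_decode (p2 (p1 z)))" if "clos ?B subst_step z" for z
    using that
  proof (induction rule: clos.induct)
    case (base z)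
    then show ?case by (auto simp: trm_decode_simps)
  next
    case (step a b z)
    from step.hyps(3) show ?case
      unfolding subst_step_def
      by (elim exE disjE conjE) (use step.IH in \<open>simp_all only: pr_simps trm_decode_simps subst.simps\<close>)
  qed
  from this[of "pr (pr u (trm_encode s)) r"]
  show "clos ?B subst_step (pr (pr u (trm_encode s)) r) \<Longrightarrow> r = trm_encode (subst (trm_decode u) s)"
    by (metis pr_simps(1,2) trm_decode_enc)
qed

lemma computable_subst:
  assumes "computable F" "computable G"
  shows "computable (\<lambda>x. trm_encode (subst (trm_decode (F x)) (trm_decode (G x))))"
proof -
  have "semidec (\<lambda>z. clos (\<lambda>z. \<exists>u. z = pr (pr u 0) u) subst_step z)"
    unfolding subst_step_def
    by (rule semidec_clos semidec_intros semidec_dec[OF dec_eq] computable_intros)+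
  then have "semidec (\<lambda>z. p2 z = trm_encode (subst (trm_decode (p1 (p1 z))) (trm_decode (p2 (p1 z)))))"
    unfolding subst_iff_clos by simp
  from computable_compose[OF computable_graph[OF this] computable_pr[OF assms]]
  show ?thesis by simp
qed

text \<open>The semidecidable matrix supplies the innermost existential quantifier.\<close>

lemma Sigma03I:
  assumes "semidec (\<lambda>z. Q (p1 z) (p1 (p2 z)) (p1 (p2 (p2 z))) (p2 (p2 (p2 z))))"
    and "\<And>x y. R x y \<longleftrightarrow> (\<exists>a. \<forall>b. Q x y a b)"
  shows "Sigma03 R"
proof -
  obtain B where B: "dec (\<lambda>z. B (p1 z) (p2 z))"
    "\<And>z. Q (p1 z) (p1 (p2 z)) (p1 (p2 (p2 z))) (p2 (p2 (p2 z))) \<longleftrightarrow> (\<exists>w. B z w)"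
    using assms(1) by (rule semidecE) (rule that)
  let ?F = "\<lambda>z. pr (pr (p1 z) (pr (p1 (p2 z)) (pr (p1 (p2 (p2 z))) (p1 (p2 (p2 (p2 z))))))) (p2 (p2 (p2 (p2 z))))"
  have F: "computable ?F" by (intro computable_intros)
  have Q: "Q x y a b \<longleftrightarrow> (\<exists>w. B (pr x (pr y (pr a b))) w)" for x y a b
    using B(2)[of "pr x (pr y (pr a b))"] by simp
  have "decidable {z. B (p1 (?F z)) (p2 (?F z))}"
    using dec_compose[OF B(1) F] by (simp only: dec_def)
  then show ?thesis
    unfolding Sigma03_def assms(2) Q
    by (intro exI[of _ "{z. B (p1 (?F z)) (p2 (?F z))}"]) (simp add: pr_def[symmetric])
qed

lemma Sigma03_iso_UF2_1: "Sigma03 iso_UF2_1"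
proof -
  have "semidec (\<lambda>z. term_eq (p1 z) (trm_decode (p1 (p2 z))) (trm_decode (p2 (p2 z))))"
    by (intro semidec_th computable_intros)
  then obtain B where B: "dec (\<lambda>z. B (p1 z) (p2 z))"
    "\<And>z. term_eq (p1 z) (trm_decode (p1 (p2 z))) (trm_decode (p2 (p2 z))) \<longleftrightarrow> (\<exists>w. B z w)"
    by (rule semidecE) (rule that)
  have term_eq: "term_eq e s t \<longleftrightarrow> (\<exists>w. B (pr e (pr (trm_encode s) (trm_encode t))) w)" for e s t
    using B(2)[of "pr e (pr (trm_encode s) (trm_encode t))"] by simp
  have decB: "dec (\<lambda>z. B (F z) (G z))" if "computable F" "computable G" for F G
    using dec_compose[OF B(1) computable_pr[OF that]] by simp
  let ?sub = "\<lambda>u s. trm_encode (subst (trm_decode u) (trm_decode s))"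
  \<comment> \<open>Here \<open>a\<close> codes \<open>(u, v)\<close> and \<open>b\<close> codes
    \<open>(s, t, w)\<close>, with \<open>w\<close> a possible witness for an equality. For fixed
    \<open>w\<close> the premise of each implication is decidable, so the whole matrix is
    semidecidable; \<open>trm_decode 0\<close> is the generator.\<close>
  define Q where "Q e i a b \<longleftrightarrow>
      term_eq i (trm_decode (?sub (p1 a) (p2 a))) (trm_decode 0) \<and>
      (\<not> B (pr e (pr (p1 b) (p1 (p2 b)))) (p2 (p2 b)) \<or>
        term_eq i (trm_decode (?sub (p1 a) (p1 b))) (trm_decode (?sub (p1 a) (p1 (p2 b))))) \<and>
      (\<not> B (pr i (pr (?sub (p1 a) (p1 b)) (?sub (p1 a) (p1 (p2 b))))) (p2 (p2 b)) \<or>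
        term_eq e (trm_decode (p1 b)) (trm_decode (p1 (p2 b))))" for e i a b
  have "semidec (\<lambda>z. Q (p1 z) (p1 (p2 z)) (p1 (p2 (p2 z))) (p2 (p2 (p2 z))))"
    unfolding Q_def
    by (rule semidec_conj semidec_disj semidec_th semidec_dec[OF dec_not] decB computable_subst computable_intros)+
  moreover have "iso_UF2_1 e i \<longleftrightarrow> (\<exists>a. \<forall>b. Q e i a b)" for e i
  proof -
    have Q: "(\<forall>b. Q e i a b) \<longleftrightarrow> term_eq i (subst (trm_decode (p1 a)) (trm_decode (p2 a))) Gen \<and>
        (\<forall>s t. term_eq e s t \<longleftrightarrow> term_eq i (subst (trm_decode (p1 a)) s) (subst (trm_decode (p1 a)) t))" (is "_ \<longleftrightarrow> ?R")
      for a
    proof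
      assume Q: "\<forall>b. Q e i a b"
      have "term_eq e s t \<longleftrightarrow> term_eq i (subst (trm_decode (p1 a)) s) (subst (trm_decode (p1 a)) t)" for s t
      proof
        assume "term_eq e s t"
        then obtain w where "B (pr e (pr (trm_encode s) (trm_encode t))) w" using term_eq by blast
        with Q[rule_format, of "pr (trm_encode s) (pr (trm_encode t) w)"]
        show "term_eq i (subst (trm_decode (p1 a)) s) (subst (trm_decode (p1 a)) t)" by (simp add: Q_def)
      next
        assume "term_eq i (subst (trm_decode (p1 a)) s) (subst (trm_decode (p1 a)) t)"
        then obtain w where
          "B (pr i (pr (trm_encode (subst (trm_decode (p1 a)) s)) (trm_encode (subst (trm_decode (p1 a)) t)))) w" using term_eq by blast
        with Q[rule_format, of "pr (trm_encode s) (pr (trm_encode t) w)"]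
        show "term_eq e s t" by (simp add: Q_def)
      qed
      moreover have "term_eq i (subst (trm_decode (p1 a)) (trm_decode (p2 a))) Gen"
        using Q by (simp add: Q_def trm_decode_simps)
      ultimately show ?R by blast
    next
      assume R: ?R
      have B1: "B (pr e (pr s t)) w \<Longrightarrow> term_eq e (trm_decode s) (trm_decode t)" for s t w
        unfolding term_eq trm_decode_enc by blast
      have B2: "B (pr i (pr (trm_encode x) (trm_encode y))) w \<Longrightarrow> term_eq i x y" for x y w
        unfolding term_eq by blast
      show "\<forall>b. Q e i a b"
        unfolding Q_def trm_decode_enc trm_decode_simps using R B1 B2 by blast
    qed
    have "(\<exists>u v. P u v) \<longleftrightarrow> (\<exists>a. P (trm_decode (p1 a)) (trm_decode (p2 a)))" for P
    proof
      assume "\<exists>u v. P u v"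
      then obtain u v where "P u v" by blast
      then show "\<exists>a. P (trm_decode (p1 a)) (trm_decode (p2 a))"
        by (intro exI[of _ "pr (trm_encode u) (trm_encode v)"]) simp
    qed blast
    then show ?thesis unfolding iso_UF2_1_iff Q .
  qed
  ultimately show ?thesis by (rule Sigma03I)
qed

section \<open>Families of cuts from an equivalence relation\<close>

text \<open>If each \<open>a\<close> failed at some level, then by antitonicity all of them would
  fail at the maximum of these finitely many levels.\<close>

lemma antitone_uniform_choice:
  fixes P :: "'a \<Rightarrow> nat \<Rightarrow> bool"
  assumes "finite F" "\<And>a j k. P a k \<Longrightarrow> j \<le> k \<Longrightarrow> P a j" "\<And>k. \<exists>a\<in>F. P a k"
  shows "\<exists>a\<in>F. \<forall>k. P a k"
proof (rule ccontr)
  assume "\<not> ?thesis"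
  then have "\<forall>a\<in>F. \<exists>k. \<not> P a k" by blast
  from bchoice[OF this] obtain K where K: "\<forall>a\<in>F. \<not> P a (K a)" by (rule exE)
  obtain a where a: "a \<in> F" "P a (Max (K ` F))" using assms(3) by blast
  have "K a \<le> Max (K ` F)" using a(1) assms(1) by simp
  from assms(2)[OF a(2) this] K a(1) show False by blast
qed

text \<open>Only finitely many edges exist. Above all levels at which some edge disappears, every
  remaining edge is permanent, and so is a path through them.\<close>

lemma antitone_rtranclp:
  fixes R :: "nat \<Rightarrow> nat \<Rightarrow> nat \<Rightarrow> bool"
  assumes bound: "\<And>k u v. R k u v \<Longrightarrow> u \<le> n \<and> v \<le> n"
    and anti: "\<And>j k u v. R k u v \<Longrightarrow> j \<le> k \<Longrightarrow> R j u v"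
    and path: "\<And>k. (R k)\<^sup>*\<^sup>* x y"
  shows "(\<lambda>u v. \<forall>k. R k u v)\<^sup>*\<^sup>* x y"
proof -
  let ?F = "{(u, v). u \<le> n \<and> v \<le> n \<and> \<not> (\<forall>k. R k u v)}"
  have fin: "finite ?F"
    by (rule finite_subset[of _ "{..n} \<times> {..n}"]) auto
  have "\<forall>p\<in>?F. \<exists>k. \<not> R k (fst p) (snd p)" by auto
  from bchoice[OF this] obtain K where K: "\<forall>p\<in>?F. \<not> R (K p) (fst p) (snd p)" by (rule exE)
  have "\<forall>k. R k u v" if "R (Max (K ` ?F)) u v" for u v
  proof (rule ccontr)
    assume "\<not> (\<forall>k. R k u v)"
    then have uv: "(u, v) \<in> ?F" using bound[OF that] by simp
    then have "K (u, v) \<le> Max (K ` ?F)" using fin by simp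
    from anti[OF that this] K uv show False by fastforce
  qed
  then have "R (Max (K ` ?F)) \<le> (\<lambda>u v. \<forall>k. R k u v)" by blast
  from rtranclp_mono[OF this] path show ?thesis by blast
qed

lemma semidec_rtranclp:
  assumes "semidec (\<lambda>z. R (p1 z) (p1 (p2 z)) (p2 (p2 z)))"
    and "computable F" "computable G" "computable H"
  shows "semidec (\<lambda>z. (R (F z))\<^sup>*\<^sup>* (G z) (H z))"
proof -
  define B where "B z \<longleftrightarrow> p1 (p2 z) = p2 (p2 z)" for z
  define S where "S z a (b::nat) \<longleftrightarrow> (\<exists>i u v w. z = pr i (pr u w) \<and> a = pr i (pr u v) \<and> R i v w)" for z a b
  have R: "semidec (\<lambda>z. R (F z) (G z) (H z))" if "computable F" "computable G" "computable H" for F G H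
    using semidec_compose[OF assms(1) computable_pr[OF that(1) computable_pr[OF that(2,3)]]] by simp
  have "clos B S (pr i (pr u v)) \<longleftrightarrow> (R i)\<^sup>*\<^sup>* u v" for i u v
  proof
    assume "(R i)\<^sup>*\<^sup>* u v"
    then show "clos B S (pr i (pr u v))"
    proof (induction rule: rtranclp_induct)
      case base
      show ?case by (rule clos.base) (simp add: B_def)
    next
      case (step v w)
      then have "S (pr i (pr u w)) (pr i (pr u v)) (pr i (pr u v))" unfolding S_def by blast
      from clos.step[OF step.IH step.IH this] show ?case .
    qed
  next
    have "(R (p1 z))\<^sup>*\<^sup>* (p1 (p2 z)) (p2 (p2 z))" if "clos B S z" for z
      using that
    proof (induction rule: clos.induct)
      case (base z)
      then show ?case by (simp add: B_def)
    next
      case (step a b z)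
      from step.hyps(3) obtain i u v w where "z = pr i (pr u w)" "a = pr i (pr u v)" "R i v w"
        unfolding S_def by (elim exE conjE)
      with step.IH(1) show ?case by simp
    qed
    from this[of "pr i (pr u v)"] show "clos B S (pr i (pr u v)) \<Longrightarrow> (R i)\<^sup>*\<^sup>* u v" by simp
  qed
  moreover have "semidec (\<lambda>z. clos B S z)"
    unfolding B_def S_def
    by (rule semidec_clos semidec_intros semidec_dec[OF dec_eq] R computable_intros)+
  ultimately show ?thesis
    using semidec_compose[of "\<lambda>z. clos B S z" "\<lambda>x. pr (F x) (pr (G x) (H x))"] assms(2-4)
    by (simp add: computable_pr)
qed

section \<open>Cuts from path capacities\<close>

text \<open>An initial segment containing 1 represents its supremum, a positive integer or infinity;
  in the overview this is \<open>m\<close>.\<close>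

definition cut_family :: "(nat \<Rightarrow> bool) \<Rightarrow> bool" where
  "cut_family P \<longleftrightarrow> P 0 \<and> P 1 \<and> (\<forall>j k. P k \<longrightarrow> j \<le> k \<longrightarrow> P j)"

lemma Sigma03_cut_families:
  assumes "equivp E" "Sigma03 E"
  obtains M where "semidec (\<lambda>z. M (p1 z) (p1 (p2 z)) (p2 (p2 z)))" "\<And>x c. cut_family (M x c)"
    "\<And>x y. E x y \<longleftrightarrow> finite {c. M x c \<noteq> M y c}"
proof -
  obtain A where A: "decidable A"
    "\<forall>x y. E x y \<longleftrightarrow> (\<exists>a. \<forall>b. \<exists>c. pr x (pr y (pr a (pr b c))) \<in> A)"
    using assms(2) unfolding Sigma03_def pr_def[symmetric] by (elim exE conjE)
  \<comment> \<open>\<open>V x y a k\<close>: the first \<open>k\<close> instances of the universal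
    quantifier have been confirmed for the candidate \<open>a\<close>.\<close>
  define V where "V x y a k \<longleftrightarrow> (\<forall>b<k. \<exists>c. pr x (pr y (pr a (pr b c))) \<in> A)" for x y a k :: nat
  have V_anti: "V x y a j" if "V x y a k" "j \<le> k" for x y a j k
    using that by (simp add: V_def)
  have V_all: "E x y \<longleftrightarrow> (\<exists>a. \<forall>k. V x y a k)" for x y
  proof -
    have "(\<forall>b. Q b) \<longleftrightarrow> (\<forall>k. \<forall>b<k. Q b)" for Q :: "nat \<Rightarrow> bool" by (meson lessI)
    then show ?thesis unfolding A(2)[rule_format] V_def by simp
  qed
  have E: "E x x" "E x y \<Longrightarrow> E y x" "E x y \<Longrightarrow> E y z \<Longrightarrow> E x z" for x y z
    by (fact equivp_reflp[OF assms(1)] equivp_symp[OF assms(1)] equivp_transp[OF assms(1)])+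
  \<comment> \<open>For \<open>i = (n, k)\<close> these are the edges of width at least
    \<open>k\<close> at stage \<open>n\<close>. They are symmetrized, since the evidence for
    \<open>E u v\<close> need not resemble that for \<open>E v u\<close>.\<close>
  define R where "R i u v \<longleftrightarrow>
      u < Suc (p1 i) \<and> v < Suc (p1 i) \<and> (\<exists>a. a < Suc (p1 i) \<and> (V u v a (p2 i) \<or> V v u a (p2 i)))" for i u v
  \<comment> \<open>The disjunct \<open>k < 2\<close> forces 0 and 1 into the segment. The bound on
    \<open>p2 c\<close> leaves finitely many relevant coordinates at each stage
    \<open>p1 c\<close>.\<close>
  define M where "M x c k \<longleftrightarrow> k < 2 \<or> p2 c < Suc (p1 c) \<and> (R (pr (p1 c) k))\<^sup>*\<^sup>* x (p2 c)" for x c k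
  have R_anti: "R (pr n j) u v" if "R (pr n k) u v" "j \<le> k" for n j k u v
  proof -
    from that(1) obtain a where "u < Suc n" "v < Suc n" "a < Suc n" "V u v a k \<or> V v u a k"
      unfolding R_def pr_simps by (elim exE conjE)
    then show ?thesis
      unfolding R_def pr_simps using V_anti[OF _ that(2)] by (intro conjI exI[of _ a]) auto
  qed
  have R_sym: "R i u v \<Longrightarrow> R i v u" for i u v
    unfolding R_def by blast
  have decA: "dec (\<lambda>z. z \<in> A)" using A(1) by (simp add: dec_def)
  have A': "semidec (\<lambda>z. F z \<in> A)" if "computable F" for F
    by (rule semidec_dec[OF dec_compose[OF decA that]])
  have sigR: "semidec (\<lambda>z. R (p1 z) (p1 (p2 z)) (p2 (p2 z)))"
    unfolding R_def V_def
    by (rule semidec_intros semidec_dec[OF dec_less] A' computable_intros)+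
  have "semidec (\<lambda>z. M (p1 z) (p1 (p2 z)) (p2 (p2 z)))"
    unfolding M_def
    by (rule semidec_intros semidec_dec[OF dec_less] semidec_rtranclp[OF sigR] computable_intros)+
  moreover have "cut_family (M x c)" for x c
  proof -
    have "M x c j" if "M x c k" "j \<le> k" for j k
    proof -
      have "R (pr (p1 c) k) \<le> R (pr (p1 c) j)"
        by (intro predicate2I) (rule R_anti[OF _ that(2)])
      from predicate2D[OF rtranclp_mono[OF this]] that show ?thesis
        unfolding M_def by auto
    qed
    then show ?thesis
      unfolding cut_family_def by (simp add: M_def)
  qed
  moreover have "E x y \<longleftrightarrow> finite {c. M x c \<noteq> M y c}" for x y
  proof
    assume "E x y"
    then obtain a where a: "\<forall>k. V x y a k" unfolding V_all by (rule exE)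
    \<comment> \<open>From stage \<open>?N\<close> on, \<open>x\<close> and \<open>y\<close> are
      joined by an edge of every width, hence reach the same vertices at every width.\<close>
    let ?N = "max a (max x y)"
    have "M x c = M y c" if "?N \<le> p1 c" for c
    proof -
      have edge: "R (pr (p1 c) k) x y" for k
        using a that unfolding R_def pr_simps by (auto simp: less_Suc_eq_le)
      have "(R (pr (p1 c) k))\<^sup>*\<^sup>* x u \<longleftrightarrow> (R (pr (p1 c) k))\<^sup>*\<^sup>* y u" for k u
        by (intro iffI; rule converse_rtranclp_into_rtranclp[of "R (pr (p1 c) k)"])
          (rule edge R_sym[OF edge], assumption)+
      then show ?thesis unfolding M_def fun_eq_iff by simp
    qed
    then have *: "p1 c < ?N" if "M x c \<noteq> M y c" for c using that not_le by blast
    have **: "p2 c \<le> p1 c" if "M x c \<noteq> M y c" for c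
      using that by (auto simp: M_def fun_eq_iff less_Suc_eq_le)
    have "{c. M x c \<noteq> M y c} \<subseteq> (\<lambda>(n, u). pr n u) ` ({..?N} \<times> {..?N})"
    proof
      fix c assume "c \<in> {c. M x c \<noteq> M y c}"
      then have "(p1 c, p2 c) \<in> {..?N} \<times> {..?N}" using *[of c] **[of c] by simp
      from imageI[OF this, of "\<lambda>(n, u). pr n u"]
      show "c \<in> (\<lambda>(n, u). pr n u) ` ({..?N} \<times> {..?N})" by simp
    qed
    then show "finite {c. M x c \<noteq> M y c}" by (rule finite_subset) simp
  next
    assume fin: "finite {c. M x c \<noteq> M y c}"
    \<comment> \<open>Among the infinitely many coordinates \<open>(n, x)\<close> some carries equal
      cuts. There \<open>x\<close> reaches itself by the empty path at every width, so
      \<open>y\<close> reaches \<open>x\<close> at every width too.\<close>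
    have "infinite ((\<lambda>n. pr n x) ` {x..})"
      by (simp add: finite_image_iff inj_on_def infinite_Ici)
    then have "\<not> (\<lambda>n. pr n x) ` {x..} \<subseteq> {c. M x c \<noteq> M y c}"
      using finite_subset[OF _ fin] by blast
    then obtain n where n: "x \<le> n" "M x (pr n x) = M y (pr n x)" by auto
    have "(R (pr n k))\<^sup>*\<^sup>* y x" for k
    proof -
      \<comment> \<open>The shift by 2 avoids the two levels that hold by default and say nothing
        about paths.\<close>
      have "M x (pr n x) (k + 2)" unfolding M_def using n(1) by simp
      then have "(R (pr n (k + 2)))\<^sup>*\<^sup>* y x" unfolding n(2) by (simp add: M_def)
      moreover have "R (pr n (k + 2)) \<le> R (pr n k)"
        by (intro predicate2I) (erule R_anti, simp)
      ultimately show ?thesis using predicate2D[OF rtranclp_mono] by metis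
    qed
    moreover have "R (pr n k) u v \<Longrightarrow> u \<le> n \<and> v \<le> n" for k u v
      unfolding R_def by simp
    ultimately have path: "(\<lambda>u v. \<forall>k. R (pr n k) u v)\<^sup>*\<^sup>* y x"
      using R_anti by (intro antitone_rtranclp[of "\<lambda>k. R (pr n k)" n y x])
    have lim: "E u v" if "\<forall>k. R (pr n k) u v" for u v
    proof -
      \<comment> \<open>A permanent edge yields \<open>E\<close>: first a single candidate
        \<open>a\<close>, then a single direction, is chosen uniformly in \<open>k\<close>.\<close>
      have "\<exists>a\<in>{..n}. \<forall>k. V u v a k \<or> V v u a k"
      proof (rule antitone_uniform_choice)
        show "V u v a j \<or> V v u a j" if "V u v a k \<or> V v u a k" "j \<le> k" for a j k
          using that(1) V_anti[OF _ that(2)] by auto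
        show "\<exists>a\<in>{..n}. V u v a k \<or> V v u a k" for k
          using that[rule_format, of k] unfolding R_def pr_simps less_Suc_eq_le by auto
      qed simp
      then obtain a where a: "\<forall>k. V u v a k \<or> V v u a k" by (elim bexE)
      have "\<exists>b\<in>UNIV. \<forall>k. if b then V u v a k else V v u a k"
      proof (rule antitone_uniform_choice)
        show "if b then V u v a j else V v u a j" if "if b then V u v a k else V v u a k" "j \<le> k" for b j k
          using that(1) V_anti[OF _ that(2)] by (cases b) simp_all
        show "\<exists>b\<in>UNIV. if b then V u v a k else V v u a k" for k
          using a[rule_format, of k] by (intro bexI[of _ "V u v a k"]) auto
      qed simp
      then obtain b where "\<forall>k. if b then V u v a k else V v u a k" by (elim bexE)
      then have "E u v \<or> E v u" unfolding V_all by (cases b) auto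
      then show ?thesis using E(2) by auto
    qed
    from path have "E y x"
    proof (induction rule: rtranclp_induct)
      case base
      show ?case by (rule E(1))
    next
      case (step u v)
      show ?case by (rule E(3)[OF step.IH lim[OF step.hyps(2)]])
    qed
    then show "E x y" by (rule E(2))
  qed
  ultimately show ?thesis using that by blast
qed

section \<open>The algebra of a family of cuts\<close>

text \<open>The number in \<open>Main \<gamma> i\<close> counts the applications of \<open>g\<close>
  since the last \<open>f\<close>. \<open>Tst \<gamma> c\<close> remembers position and coordinate,
  so that distinct failed tests stay distinct.\<close>

datatype state = Main "nat \<Rightarrow> rat" nat | Tst "nat \<Rightarrow> rat" nat

fun g_state :: "state \<Rightarrow> state" where
  "g_state (Main \<gamma> i) = Main \<gamma> (Suc i)"
| "g_state (Tst \<gamma> c) = Tst \<gamma> c"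

text \<open>
  The composites \<open>f \<circ> g\<^sup>i\<close> simulate infinitely many operations. The one for
  \<open>i = (c, a, b)\<close> adds \<open>1/a - 1/b\<close> at coordinate \<open>c\<close>, where \<open>1/0 = 0\<close> makes index \<open>0\<close>
  stand for the limit cut; the otherwise useless case \<open>a = b\<close> is the test of \<open>c\<close>.
\<close>

fun f_state :: "state \<Rightarrow> state" where
  "f_state (Main \<gamma> i) =
     (let c = p1 i; a = p1 (p2 i); b = p2 (p2 i) in
      if a = b then Tst \<gamma> c else Main (\<gamma>(c := \<gamma> c + 1 / of_nat a - 1 / of_nat b)) 0)"
| "f_state (Tst \<gamma> c) = Tst \<gamma> c"

primrec ev :: "trm \<Rightarrow> state" where
  "ev Gen = Main (\<lambda>_. 0) 0"
| "ev (Ap_f t) = f_state (ev t)"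
| "ev (Ap_g t) = g_state (ev t)"

text \<open>Existence of a suitable \<open>k\<close> is c.e. together with \<open>M\<close>,
  although the supremum of \<open>M c\<close> need not be computable. The condition
  \<open>k > 0\<close> matters: \<open>M c 0\<close> always holds for cut families, and
  \<open>1/0 = 0\<close> would move every cut to 0.\<close>

fun passes :: "(nat \<Rightarrow> nat \<Rightarrow> bool) \<Rightarrow> state \<Rightarrow> bool" where
  "passes M (Main \<gamma> i) \<longleftrightarrow> False"
| "passes M (Tst \<gamma> c) \<longleftrightarrow> (\<exists>k>0. M c k \<and> \<gamma> c < - 1 / of_nat k)"

definition ker :: "(nat \<Rightarrow> nat \<Rightarrow> bool) \<Rightarrow> trm \<Rightarrow> trm \<Rightarrow> bool" where
  "ker M s t \<longleftrightarrow> ev s = ev t \<or> passes M (ev s) \<and> passes M (ev t)"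

lemma passes_fixed: "passes M \<sigma> \<Longrightarrow> f_state \<sigma> = \<sigma> \<and> g_state \<sigma> = \<sigma>"
  by (cases \<sigma>) simp_all

text \<open>Passing states are fixed by both operations, so collapsing them to one point already
  gives a congruence.\<close>

lemma tcong_ker: "tcong {(s, t). ker M s t} s t \<longleftrightarrow> ker M s t"
proof
  assume "tcong {(s, t). ker M s t} s t"
  then show "ker M s t"
    by (induction rule: tcong.induct) (auto simp: ker_def passes_fixed)
qed (simp add: tcong.rel)

section \<open>Translations and reachable positions\<close>

fun translate :: "(nat \<Rightarrow> rat) \<Rightarrow> state \<Rightarrow> state" where
  "translate \<delta> (Main \<gamma> i) = Main (\<lambda>c. \<gamma> c + \<delta> c) i"
| "translate \<delta> (Tst \<gamma> c) = Tst (\<lambda>c. \<gamma> c + \<delta> c) c"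

lemma f_state_translate: "f_state (translate \<delta> \<sigma>) = translate \<delta> (f_state \<sigma>)"
  by (cases \<sigma>) (auto simp: Let_def fun_eq_iff)

lemma g_state_translate: "g_state (translate \<delta> \<sigma>) = translate \<delta> (g_state \<sigma>)"
  by (cases \<sigma>) auto

text \<open>The operations add constants, hence commute with translations. With counter 0 the new
  generator is a translate of the old one, and so is everything generated.\<close>

lemma ev_subst: "ev u = Main \<delta> 0 \<Longrightarrow> ev (subst u t) = translate \<delta> (ev t)"
  by (induction t) (simp_all add: f_state_translate g_state_translate)

lemma translate_inject: "translate \<delta> \<sigma> = translate \<delta> \<tau> \<longleftrightarrow> \<sigma> = \<tau>"
  by (cases \<sigma>; cases \<tau>) (auto simp: fun_eq_iff)

lemma ev_Ap_g_funpow: "ev u = Main \<gamma> i \<Longrightarrow> ev ((Ap_g ^^ n) u) = Main \<gamma> (i + n)"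
  by (induction n) simp_all

lemma ev_move:
  assumes "ev u = Main \<gamma> 0" "a \<noteq> b"
  shows "\<exists>t. ev t = Main (\<gamma>(c := \<gamma> c + 1 / of_nat a - 1 / of_nat b)) 0"
  by (rule exI[of _ "Ap_f ((Ap_g ^^ pr c (pr a b)) u)"])
    (simp add: ev_Ap_g_funpow[OF assms(1)] assms(2))

lemma ev_test:
  assumes "ev u = Main \<gamma> 0"
  shows "\<exists>t. ev t = Tst \<gamma> c"
  by (rule exI[of _ "Ap_f ((Ap_g ^^ pr c (pr 0 0)) u)"])
    (simp add: ev_Ap_g_funpow[OF assms(1)])

lemma ev_moves:
  assumes "finite {c. a c \<noteq> b c}"
  shows "\<exists>t. ev t = Main (\<lambda>c. 1 / of_nat (a c) - 1 / of_nat (b c)) 0"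
proof -
  have "\<exists>t. ev t = Main (\<lambda>c. if c \<in> D then 1 / of_nat (a c) - 1 / of_nat (b c) else 0) 0"
    if "finite D" "\<And>c. c \<in> D \<Longrightarrow> a c \<noteq> b c" for D
    using that
  proof (induction D rule: finite_induct)
    case empty
    show ?case by (rule exI[of _ Gen]) simp
  next
    case (insert d D)
    then obtain t where t: "ev t = Main (\<lambda>c. if c \<in> D then 1 / of_nat (a c) - 1 / of_nat (b c) else 0) 0"
      by auto
    have "a d \<noteq> b d" using insert.prems by simp
    from ev_move[OF t this, of d] obtain s where
      s: "ev s = Main ((\<lambda>c. if c \<in> D then 1 / of_nat (a c) - 1 / of_nat (b c) else 0)
        (d := (if d \<in> D then 1 / of_nat (a d) - 1 / of_nat (b d) else 0) + 1 / of_nat (a d) - 1 / of_nat (b d))) 0"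
      by (rule exE)
    show ?case
      by (rule exI[of _ s], unfold s) (use insert.hyps(2) in \<open>auto simp: fun_eq_iff\<close>)
  qed
  \<comment> \<open>Where \<open>a c = b c\<close> the difference is 0, so the restriction to the
    finite set changes nothing.\<close>
  from this[OF assms] show ?thesis by (auto elim!: back_subst[where P = "\<lambda>\<gamma>. \<exists>t. ev t = Main \<gamma> 0"])
qed

section \<open>Almost equal cut families give isomorphic algebras\<close>

text \<open>Take \<open>m\<close> to be the maximum of the segment, or 0 if it is unbounded: then
  \<open>- 1 / 0 = 0\<close> is the limit cut.\<close>

lemma cut_exists:
  assumes "cut_family P"
  shows "\<exists>m. \<forall>q::rat. (\<exists>k>0. P k \<and> q < - 1 / of_nat k) \<longleftrightarrow> q < - 1 / of_nat m"
proof (cases "\<forall>k. P k")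
  case True
  have "(\<exists>k>0. P k \<and> q < - 1 / of_nat k) \<longleftrightarrow> q < 0" for q :: rat
  proof
    assume "\<exists>k>0. P k \<and> q < - 1 / of_nat k"
    then obtain k where "q < - 1 / of_nat k" by (elim exE conjE)
    moreover have "- 1 / of_nat k \<le> (0::rat)" by simp
    ultimately show "q < 0" by (rule order.strict_trans2)
  next
    assume "q < 0"
    then have "0 < - q" by simp
    from ex_inverse_of_nat_less[OF this]
    obtain n where n: "n > 0" "inverse (of_nat n) < - q" by (elim exE conjE)
    have "- 1 / of_nat n = - inverse (of_nat n :: rat)" by (simp add: divide_inverse)
    then have "q < - 1 / of_nat n" using n(2) by simp
    with n(1) True show "\<exists>k>0. P k \<and> q < - 1 / of_nat k" by (intro exI[of _ n]) simp
  qed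
  then show ?thesis by (intro exI[of _ 0]) simp
next
  case False
  then obtain l where l: "\<not> P l" by blast
  have bound: "k < l" if "P k" for k
  proof (rule ccontr)
    assume "\<not> k < l"
    then have "l \<le> k" by simp
    with assms that l show False by (auto simp: cut_family_def)
  qed
  define m where "m = Max {k. P k}"
  have "{k. P k} \<subseteq> {..<l}" using bound by auto
  then have fin: "finite {k. P k}" by (rule finite_subset) simp
  have "1 \<in> {k. P k}" using assms by (simp add: cut_family_def)
  then have "m \<in> {k. P k}" "1 \<le> m"
    using Max_in[OF fin] Max_ge[OF fin] unfolding m_def by blast+
  then have m: "P m" "0 < m" by simp_all
  have "(\<exists>k>0. P k \<and> q < - 1 / of_nat k) \<longleftrightarrow> q < - 1 / of_nat m" for q :: rat
  proof
    assume "\<exists>k>0. P k \<and> q < - 1 / of_nat k"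
    then obtain k where k: "k > 0" "P k" "q < - 1 / of_nat k" by (elim exE conjE)
    have "k \<le> m" using Max_ge[OF fin, of k] k(2) by (simp add: m_def)
    then have "- 1 / of_nat k \<le> (- 1 / of_nat m :: rat)"
      using k(1) by (simp add: frac_le)
    with k(3) show "q < - 1 / of_nat m" by (rule order.strict_trans2)
  next
    assume "q < - 1 / of_nat m"
    with m show "\<exists>k>0. P k \<and> q < - 1 / of_nat k" by (intro exI[of _ m] conjI)
  qed
  then show ?thesis by (intro exI[of _ m] allI)
qed

lemma ker_embedding:
  assumes "\<And>c. cut_family (M c)" "\<And>c. cut_family (N c)" "finite {c. M c \<noteq> N c}"
  shows "\<exists>u v. ker N (subst u v) Gen \<and> (\<forall>s t. ker M s t \<longleftrightarrow> ker N (subst u s) (subst u t))"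
proof -
  \<comment> \<open>The cut index is chosen as a function of the segment and not of the coordinate,
    so that \<open>M c = N c\<close> forces \<open>a c = b c\<close>.\<close>
  have "\<forall>P. \<exists>m. cut_family P \<longrightarrow> (\<forall>q::rat. (\<exists>k>0. P k \<and> q < - 1 / of_nat k) \<longleftrightarrow> q < - 1 / of_nat m)"
    using cut_exists by simp
  from choice[OF this] obtain \<kappa> where "\<forall>P. cut_family P \<longrightarrow>
      (\<forall>q::rat. (\<exists>k>0. P k \<and> q < - 1 / of_nat k) \<longleftrightarrow> q < - 1 / of_nat (\<kappa> P))"
    by (rule exE)
  then have \<kappa>: "(\<exists>k>0. P k \<and> q < - 1 / of_nat k) \<longleftrightarrow> q < (- 1 / of_nat (\<kappa> P) :: rat)"
    if "cut_family P" for P q using that by simp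
  define a where "a c = \<kappa> (M c)" for c
  define b where "b c = \<kappa> (N c)" for c
  \<comment> \<open>Translation by \<open>\<delta>\<close> carries the cut \<open>- 1 / a c\<close>
    to \<open>- 1 / b c\<close>; its inverse has the roles of \<open>a\<close> and \<open>b\<close>
    exchanged.\<close>
  define \<delta> :: "nat \<Rightarrow> rat" where "\<delta> c = 1 / of_nat (a c) - 1 / of_nat (b c)" for c
  have "{c. a c \<noteq> b c} \<subseteq> {c. M c \<noteq> N c}" unfolding a_def b_def by auto
  then have fin: "finite {c. a c \<noteq> b c}" using assms(3) by (rule finite_subset)
  obtain u where u: "ev u = Main \<delta> 0"
    using ev_moves[OF fin] unfolding \<delta>_def by (rule exE)
  have "finite {c. b c \<noteq> a c}" using fin by (rule back_subst) auto
  from ev_moves[OF this] obtain v where v: "ev v = Main (\<lambda>c. 1 / of_nat (b c) - 1 / of_nat (a c)) 0"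
    by (rule exE)
  have "ker N (subst u v) Gen"
    unfolding ker_def ev_subst[OF u] v by (simp add: \<delta>_def)
  moreover have "passes N (translate \<delta> \<sigma>) \<longleftrightarrow> passes M \<sigma>" for \<sigma>
  proof (cases \<sigma>)
    case (Tst \<gamma> c)
    have "\<gamma> c + \<delta> c < - 1 / of_nat (b c) \<longleftrightarrow> \<gamma> c < - 1 / of_nat (a c)"
      by (auto simp: \<delta>_def)
    then show ?thesis
      unfolding Tst translate.simps passes.simps \<kappa>[OF assms(1)] \<kappa>[OF assms(2)] a_def b_def .
  qed simp
  then have "ker M s t \<longleftrightarrow> ker N (subst u s) (subst u t)" for s t
    by (simp add: ker_def ev_subst[OF u] translate_inject)
  ultimately show ?thesis by (intro exI[of _ u] exI[of _ v] conjI allI)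
qed

section \<open>Isomorphic algebras have almost equal cut families\<close>

lemma finite_support_ev: "ev t = Main \<gamma> i \<Longrightarrow> finite {c. \<gamma> c \<noteq> 0}"
proof (induction t arbitrary: \<gamma> i)
  case (Ap_f t)
  then show ?case
  proof (cases "ev t")
    case (Main \<gamma>' i')
    then have "{c. \<gamma> c \<noteq> 0} \<subseteq> insert (p1 i') {c. \<gamma>' c \<noteq> 0}"
      using Ap_f.prems by (auto simp: Let_def split: if_splits)
    then show ?thesis using Ap_f.IH[OF Main] by (meson finite_insert finite_subset)
  qed simp
next
  case (Ap_g t)
  then show ?case by (cases "ev t") auto
qed simp

lemma ev_subst_Tst: "ev u = Tst \<gamma> c \<Longrightarrow> ev (subst u t) = Tst \<gamma> c"
  by (induction t) simp_all

lemma ev_subst_cong: "ev u = ev v \<Longrightarrow> ev (subst u t) = ev (subst v t)"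
  by (induction t) simp_all

lemma ker_Gen: "ker M s Gen \<longleftrightarrow> ev s = Main (\<lambda>_. 0) 0"
  by (simp add: ker_def)

lemma ev_Main_Suc: "ev u = Main \<gamma> (Suc i) \<Longrightarrow> \<exists>t. u = Ap_g t"
proof (cases u)
  case (Ap_f t)
  assume "ev u = Main \<gamma> (Suc i)"
  then show ?thesis using Ap_f by (cases "ev t") (auto simp: Let_def split: if_splits)
qed simp_all

text \<open>The rational \<open>- 1 / (k - 1)\<close> lies below \<open>- 1 / j\<close> exactly when
  \<open>j \<ge> k\<close>, so a single test at it decides \<open>P k\<close>. For
  \<open>k \<ge> 2\<close> the denominator is positive.\<close>

lemma cut_family_pred:
  assumes "cut_family P" "2 \<le> k"
  shows "P k \<longleftrightarrow> (\<exists>j>0. P j \<and> - 1 / of_nat (k - 1) < (- 1 / of_nat j :: rat))"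
proof
  assume "P k"
  moreover have "- 1 / of_nat (k - 1) < (- 1 / of_nat k :: rat)"
    using assms(2) by (simp add: divide_strict_left_mono)
  ultimately show "\<exists>j>0. P j \<and> - 1 / of_nat (k - 1) < (- 1 / of_nat j :: rat)"
    using assms(2) by (intro exI[of _ k]) simp
next
  assume "\<exists>j>0. P j \<and> - 1 / of_nat (k - 1) < (- 1 / of_nat j :: rat)"
  then obtain j where j: "j > 0" "P j" "- 1 / of_nat (k - 1) < (- 1 / of_nat j :: rat)" by blast
  have "k - 1 < j"
  proof (rule ccontr)
    assume "\<not> k - 1 < j"
    then have "- 1 / of_nat j \<le> (- 1 / of_nat (k - 1) :: rat)"
      using j(1) by (simp add: frac_le)
    with j(3) show False by simp
  qed
  then have "k \<le> j" by simp
  with assms(1) j(2) show "P k" unfolding cut_family_def by blast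
qed

text \<open>The generator must go to a position \<open>\<delta>\<close> with counter 0, which has
  finite support. Off the support nothing is moved, and tests at rational points recover the
  segments.\<close>

lemma ker_embedding_imp_finite:
  assumes M: "\<And>c. cut_family (M c)" and N: "\<And>c. cut_family (N c)"
    and uv: "ker N (subst u v) Gen"
    and iff: "\<And>s t. ker M s t \<longleftrightarrow> ker N (subst u s) (subst u t)"
  shows "finite {c. M c \<noteq> N c}"
proof -
  have ev_uv: "ev (subst u v) = Main (\<lambda>_. 0) 0" using uv by (simp add: ker_Gen)
  obtain \<delta> i where ui: "ev u = Main \<delta> i"
  proof (cases "ev u")
    \<comment> \<open>A test result is fixed by every term, so the generator could not be reached
      from it.\<close>
    case (Tst \<gamma> c)
    from ev_subst_Tst[OF this, of v] ev_uv show ?thesis by simp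
  qed (rule that)
  have "i = 0"
  proof (rule ccontr)
    assume "i \<noteq> 0"
    then obtain j where "i = Suc j" by (cases i) simp_all
    with ui ev_Main_Suc obtain w where w: "u = Ap_g w" by blast
    \<comment> \<open>\<open>u[v]\<close> is then equal to the generator in the source algebra, but it lies in the range of \<open>g\<close>.\<close>
    have "ev (subst (subst u v) u) = ev (subst Gen u)"
      by (rule ev_subst_cong) (simp add: ev_uv)
    then have "ker N (subst u (subst v u)) (subst u Gen)"
      by (simp add: ker_def subst_subst)
    then have "ker M (subst v u) Gen" unfolding iff .
    then have "g_state (ev (subst v w)) = Main (\<lambda>_. 0) 0" by (simp add: ker_Gen w)
    then show False by (cases "ev (subst v w)") simp_all
  qed
  with ui have u: "ev u = Main \<delta> 0" by simp
  have "M c = N c" if c: "\<delta> c = 0" for c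
  proof
    fix k
    show "M c k = N c k"
    proof (cases "k < 2")
      case True
      then have "k = 0 \<or> k = 1" by linarith
      then show ?thesis using M[of c] N[of c] by (auto simp: cut_family_def)
    next
      case False
      then have k: "2 \<le> k" "0 \<noteq> k - 1" by simp_all
      \<comment> \<open>This move uses \<open>1/0 = 0\<close>: index 0 and index
        \<open>k - 1\<close> give the displacement \<open>- 1 / (k - 1)\<close>.\<close>
      obtain s1 where "ev s1 = Main ((\<lambda>_. 0)(c := - 1 / of_nat (k - 1))) 0"
        using ev_move[of Gen _ 0 "k - 1" c] k(2) by auto
      from ev_test[OF this, of c] obtain s where s: "ev s = Tst ((\<lambda>_. 0)(c := - 1 / of_nat (k - 1))) c"
        by (rule exE)
      \<comment> \<open>One move adds at least \<open>- 1\<close>, so \<open>- 2\<close> takes two.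
        The test at \<open>- 2\<close> passes for every cut family because 1 belongs to it; thus
        \<open>s\<close> and \<open>t\<close> are identified iff the test of \<open>s\<close>
        passes.\<close>
      obtain t1 where t1: "ev t1 = Main ((\<lambda>_. 0)(c := - 1)) 0"
        using ev_move[of Gen _ 0 1 c] by auto
      obtain t2 where "ev t2 = Main ((\<lambda>_. 0)(c := - 2)) 0"
        using ev_move[OF t1, of 0 1 c] by auto
      from ev_test[OF this, of c] obtain t where t: "ev t = Tst ((\<lambda>_. 0)(c := - 2)) c"
        by (rule exE)
      have low: "\<exists>j>0. P j \<and> - 2 < (- 1 / of_nat j :: rat)" if "cut_family P" for P
        using that by (intro exI[of _ 1]) (simp add: cut_family_def)
      have "- 1 / of_nat (k - 1) \<ge> (- 1 :: rat)" using k by (simp add: divide_simps)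
      then have ne: "- 1 / of_nat (k - 1) \<noteq> (- 2 :: rat)" by (intro notI) simp
      have "ev s \<noteq> ev t" using ne unfolding s t by (metis fun_upd_same state.inject(2))
      then have "ker M s t \<longleftrightarrow> M c k"
        using low[OF M[of c]] cut_family_pred[OF M[of c] k(1)] by (simp add: ker_def s t)
      \<comment> \<open>As \<open>\<delta> c = 0\<close>, the translated tests probe
        \<open>N c\<close> at the same two rationals.\<close>
      moreover have "ker N (subst u s) (subst u t) \<longleftrightarrow> N c k"
        using low[OF N[of c]] cut_family_pred[OF N[of c] k(1)] \<open>ev s \<noteq> ev t\<close>
        unfolding ker_def ev_subst[OF u] translate_inject by (simp add: s t c)
      ultimately show ?thesis using iff by simp
    qed
  qed
  then have "{c. M c \<noteq> N c} \<subseteq> {c. \<delta> c \<noteq> 0}" by blast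
  then show ?thesis using finite_support_ev[OF u] by (rule finite_subset)
qed

section \<open>Semidecidability of the kernel\<close>

text \<open>Agrees with \<open>x = K * (1/a)\<close>, including the convention \<open>1/0 = 0\<close>.\<close>

definition is_quotient :: "nat \<Rightarrow> nat \<Rightarrow> nat \<Rightarrow> bool" where
  "is_quotient K a x \<longleftrightarrow> x * a = K \<or> a = 0 \<and> x = 0"

lemma of_nat_is_quotient: "0 < K \<Longrightarrow> is_quotient K a x \<Longrightarrow> of_nat x = of_nat K * (1 / of_nat a :: rat)"
  unfolding is_quotient_def by (auto simp: field_simps)

lemma is_quotient_exists: "(a = 0 \<or> a dvd K) \<Longrightarrow> \<exists>x. is_quotient K a x"
  unfolding is_quotient_def by (metis dvd_def mult.commute)

definition config :: "nat \<Rightarrow> nat \<Rightarrow> nat \<Rightarrow> nat \<Rightarrow> nat \<Rightarrow> nat \<Rightarrow> nat \<Rightarrow> nat" where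
  "config K c t m p n i = pr K (pr c (pr t (pr m (pr p (pr n i)))))"

lemma config_eq_iff [simp]: "config K c t m p n i = config K' c' t' m' p' n' i' \<longleftrightarrow>
    K = K' \<and> c = c' \<and> t = t' \<and> m = m' \<and> p = p' \<and> n = n' \<and> i = i'"
  by (simp add: config_def)

text \<open>
  A derivable \<open>config K c t m p n i\<close> says that the term coded by \<open>t\<close> evaluates to a position
  (\<open>m = 0\<close>) or a test (\<open>m = 1\<close>) with index \<open>i\<close> and with value \<open>(p - n)/K\<close> at coordinate \<open>c\<close>.
  Every sufficiently divisible \<open>K\<close> is possible.
\<close>

definition config_base :: "nat \<Rightarrow> bool" where
  "config_base z \<longleftrightarrow> (\<exists>K c. z = config K c 0 0 0 0 0)"

text \<open>The clauses are, in order: \<open>g\<close> on a position, \<open>g\<close> on a test,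
  \<open>f\<close> on a test, \<open>f\<close> performing a test, a move elsewhere, and a move at
  \<open>c\<close>. The coordinate \<open>c\<close> is fixed along a derivation, so one rational has
  to be tracked; the pair \<open>p\<close>, \<open>n\<close> avoids negative numbers.\<close>

definition config_step :: "nat \<Rightarrow> nat \<Rightarrow> nat \<Rightarrow> bool" where
  "config_step z y y' \<longleftrightarrow> (\<exists>K c t p n i d a b x x'.
     z = config K c (2 * t + 2) 0 p n (Suc i) \<and> y = config K c t 0 p n i \<or>
     z = config K c (2 * t + 2) 1 p n i \<and> y = config K c t 1 p n i \<or>
     z = config K c (2 * t + 1) 1 p n i \<and> y = config K c t 1 p n i \<or>
     z = config K c (2 * t + 1) 1 p n d \<and> y = config K c t 0 p n (pr d (pr a a)) \<or>
     a \<noteq> b \<and> d \<noteq> c \<and> z = config K c (2 * t + 1) 0 p n 0 \<and> y = config K c t 0 p n (pr d (pr a b)) \<or>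
     a \<noteq> b \<and> is_quotient K a x \<and> is_quotient K b x' \<and>
       z = config K c (2 * t + 1) 0 (p + x) (n + x') 0 \<and> y = config K c t 0 p n (pr c (pr a b)))"

lemma config_step_intros:
  "config_step (config K c (2 * t + 2) 0 p n (Suc i)) (config K c t 0 p n i) y'"
  "config_step (config K c (2 * t + 2) 1 p n i) (config K c t 1 p n i) y'"
  "config_step (config K c (2 * t + 1) 1 p n i) (config K c t 1 p n i) y'"
  "config_step (config K c (2 * t + 1) 1 p n d) (config K c t 0 p n (pr d (pr a a))) y'"
  "a \<noteq> b \<Longrightarrow> d \<noteq> c \<Longrightarrow>
     config_step (config K c (2 * t + 1) 0 p n 0) (config K c t 0 p n (pr d (pr a b))) y'"
  "a \<noteq> b \<Longrightarrow> is_quotient K a x \<Longrightarrow> is_quotient K b x' \<Longrightarrow>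
     config_step (config K c (2 * t + 1) 0 (p + x) (n + x') 0) (config K c t 0 p n (pr c (pr a b))) y'"
  unfolding config_step_def by blast+

abbreviation "config_clos \<equiv> clos config_base config_step"

definition mk_state :: "nat \<Rightarrow> (nat \<Rightarrow> rat) \<Rightarrow> nat \<Rightarrow> state" where
  "mk_state m \<gamma> i = (if m = 0 then Main \<gamma> i else Tst \<gamma> i)"

text \<open>Statements with \<open>K = 0\<close> are derivable as well but denote no fraction, hence
  the premise \<open>0 < K\<close>.\<close>

definition config_meaning :: "nat \<Rightarrow> bool" where
  "config_meaning z \<longleftrightarrow> (\<forall>K c t m p n i. z = config K c t m p n i \<longrightarrow> 0 < K \<longrightarrow> m < 2 \<and>
     (\<exists>\<gamma>. ev (trm_decode t) = mk_state m \<gamma> i \<and> of_nat p - of_nat n = of_nat K * \<gamma> c))"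

lemma config_meaning_config: "config_meaning (config K c t m p n i) \<longleftrightarrow> (0 < K \<longrightarrow> m < 2 \<and>
     (\<exists>\<gamma>. ev (trm_decode t) = mk_state m \<gamma> i \<and> of_nat p - of_nat n = of_nat K * \<gamma> c))"
  unfolding config_meaning_def config_eq_iff by blast

lemma config_sound: "config_clos z \<Longrightarrow> config_meaning z"
proof (induction rule: clos.induct)
  case (base z)
  then obtain K c where "z = config K c 0 0 0 0 0" unfolding config_base_def by (elim exE)
  then show ?case by (simp add: config_meaning_config trm_decode_simps mk_state_def)
next
  case (step y y' z)
  from step.hyps(3) show ?case
    unfolding config_step_def
  proof (elim exE disjE conjE)
    fix K c t p n i d a b x x'
    assume z: "z = config K c (2 * t + 2) 0 p n (Suc i)" and y: "y = config K c t 0 p n i"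
    show ?thesis using step.IH(1) unfolding z y config_meaning_config trm_decode_simps by (auto simp: mk_state_def)
  next
    fix K c t p n i d a b x x'
    assume z: "z = config K c (2 * t + 2) 1 p n i" and y: "y = config K c t 1 p n i"
    show ?thesis using step.IH(1) unfolding z y config_meaning_config trm_decode_simps by (auto simp: mk_state_def)
  next
    fix K c t p n i d a b x x'
    assume z: "z = config K c (2 * t + 1) 1 p n i" and y: "y = config K c t 1 p n i"
    show ?thesis using step.IH(1) unfolding z y config_meaning_config trm_decode_simps by (auto simp: mk_state_def)
  next
    fix K c t p n i d a b x x'
    assume z: "z = config K c (2 * t + 1) 1 p n d" and y: "y = config K c t 0 p n (pr d (pr a a))"
    show ?thesis using step.IH(1) unfolding z y config_meaning_config trm_decode_simps by (auto simp: mk_state_def)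
  next
    fix K c t p n i d a b x x'
    assume ab: "a \<noteq> b" "d \<noteq> c" and z: "z = config K c (2 * t + 1) 0 p n 0"
      and y: "y = config K c t 0 p n (pr d (pr a b))"
    show ?thesis using step.IH(1) ab unfolding z y config_meaning_config trm_decode_simps by (auto simp: mk_state_def)
  next
    fix K c t p n i d a b x x'
    assume ab: "a \<noteq> b" and q: "is_quotient K a x" "is_quotient K b x'"
      and z: "z = config K c (2 * t + 1) 0 (p + x) (n + x') 0"
      and y: "y = config K c t 0 p n (pr c (pr a b))"
    have "\<exists>\<gamma>. ev (trm_decode (2 * t + 1)) = mk_state 0 \<gamma> 0 \<and> of_nat (p + x) - of_nat (n + x') = of_nat K * \<gamma> c"
      if K: "0 < K"
    proof -
      obtain \<gamma> where \<gamma>: "ev (trm_decode t) = Main \<gamma> (pr c (pr a b))" "of_nat p - of_nat n = of_nat K * \<gamma> c"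
        using step.IH(1) K unfolding y config_meaning_config mk_state_def by auto
      have "of_nat (p + x) - of_nat (n + x') = of_nat K * (\<gamma> c + 1 / of_nat a - 1 / of_nat b)"
        using \<gamma>(2) of_nat_is_quotient[OF K q(1)] of_nat_is_quotient[OF K q(2)] by (simp add: algebra_simps)
      then show ?thesis
        unfolding trm_decode_simps ev.simps \<gamma>(1) mk_state_def using ab
        by (intro exI[of _ "\<gamma>(c := \<gamma> c + 1 / of_nat a - 1 / of_nat b)"]) simp
    qed
    then show ?thesis unfolding z config_meaning_config by simp
  qed
qed

lemma config_complete:
  "\<exists>K0>0. \<forall>K>0. K0 dvd K \<longrightarrow> (\<forall>m \<gamma> i. m < 2 \<longrightarrow> ev t = mk_state m \<gamma> i \<longrightarrow>
     (\<exists>p n. config_clos (config K c (trm_encode t) m p n i)))"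
proof (induction t)
  case Gen
  show ?case
  proof (rule exI[of _ 1], intro conjI allI impI)
    fix K m i :: nat and \<gamma> assume "ev Gen = mk_state m \<gamma> i"
    then have "m = 0" "i = 0" by (simp_all add: mk_state_def split: if_splits)
    moreover have "config_clos (config K c 0 0 0 0 0)"
      by (rule clos.base) (unfold config_base_def, blast)
    ultimately show "\<exists>p n. config_clos (config K c (trm_encode Gen) m p n i)" by auto
  qed simp
next
  case (Ap_g t)
  then obtain K0 where K0: "0 < K0" "\<forall>K>0. K0 dvd K \<longrightarrow> (\<forall>m \<gamma> i. m < 2 \<longrightarrow> ev t = mk_state m \<gamma> i \<longrightarrow>
     (\<exists>p n. config_clos (config K c (trm_encode t) m p n i)))" by (elim exE conjE)
  show ?case
  proof (rule exI[of _ K0], intro conjI allI impI)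
    fix K m i :: nat and \<gamma> assume K: "0 < K" "K0 dvd K" and m: "m < 2" "ev (Ap_g t) = mk_state m \<gamma> i"
    note IH = K0(2)[rule_format, OF K]
    show "\<exists>p n. config_clos (config K c (trm_encode (Ap_g t)) m p n i)"
    proof (cases "ev t")
      case (Main \<gamma>' j)
      then have "m = 0" "i = Suc j" using m by (simp_all add: mk_state_def split: if_splits)
      moreover obtain p n where "config_clos (config K c (trm_encode t) 0 p n j)"
        using IH[of 0 \<gamma>' j] Main by (auto simp: mk_state_def)
      from clos.step[OF this this config_step_intros(1)]
      have "config_clos (config K c (trm_encode (Ap_g t)) 0 p n (Suc j))" by (simp only: trm_encode.simps)
      ultimately show ?thesis by blast
    next
      case (Tst \<gamma>' j)
      then have "m = 1" "i = j" using m by (simp_all add: mk_state_def split: if_splits)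
      moreover obtain p n where "config_clos (config K c (trm_encode t) 1 p n j)"
        using IH[of 1 \<gamma>' j] Tst by (auto simp: mk_state_def)
      from clos.step[OF this this config_step_intros(2)]
      have "config_clos (config K c (trm_encode (Ap_g t)) 1 p n j)" by (simp only: trm_encode.simps)
      ultimately show ?thesis by blast
    qed
  qed (rule K0(1))
next
  case (Ap_f t)
  then obtain K0 where K0: "0 < K0" "\<forall>K>0. K0 dvd K \<longrightarrow> (\<forall>m \<gamma> i. m < 2 \<longrightarrow> ev t = mk_state m \<gamma> i \<longrightarrow>
     (\<exists>p n. config_clos (config K c (trm_encode t) m p n i)))" by (elim exE conjE)
  show ?case
  proof (cases "ev t")
    case (Tst \<gamma>' j)
    show ?thesis
    proof (rule exI[of _ K0], intro conjI allI impI)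
      fix K m i :: nat and \<gamma> assume K: "0 < K" "K0 dvd K" and m: "m < 2" "ev (Ap_f t) = mk_state m \<gamma> i"
      note IH = K0(2)[rule_format, OF K]
      have "m = 1" "i = j" using m Tst by (simp_all add: mk_state_def split: if_splits)
      moreover obtain p n where "config_clos (config K c (trm_encode t) 1 p n j)"
        using IH[of 1 \<gamma>' j] Tst by (auto simp: mk_state_def)
      from clos.step[OF this this config_step_intros(3)]
      have "config_clos (config K c (trm_encode (Ap_f t)) 1 p n j)" by (simp only: trm_encode.simps)
      ultimately show "\<exists>p n. config_clos (config K c (trm_encode (Ap_f t)) m p n i)" by blast
    qed (rule K0(1))
  next
    case (Main \<gamma>' j)
    define d a b where dab: "d = p1 j" "a = p1 (p2 j)" "b = p2 (p2 j)"
    have j: "j = pr d (pr a b)" by (simp add: dab)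
    \<comment> \<open>The maxima replace index 0, which denotes the value 0 and demands no
      divisibility.\<close>
    show ?thesis
    proof (rule exI[of _ "K0 * (max a 1 * max b 1)"], intro conjI allI impI)
      show "0 < K0 * (max a 1 * max b 1)" using K0(1) by (simp add: less_max_iff_disj)
      fix K m i :: nat and \<gamma>
      assume K: "0 < K" "K0 * (max a 1 * max b 1) dvd K" and m: "m < 2" "ev (Ap_f t) = mk_state m \<gamma> i"
      have "K0 dvd K" using K(2) by (rule dvd_mult_left)
      then obtain p n where pn: "config_clos (config K c (trm_encode t) 0 p n j)"
        using K0(2)[rule_format, OF K(1), of 0 \<gamma>' j] Main by (auto simp: mk_state_def)
      show "\<exists>p n. config_clos (config K c (trm_encode (Ap_f t)) m p n i)"
      proof (cases "a = b")
        case True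
        then have "m = 1" "i = d" using m Main by (simp_all add: mk_state_def j split: if_splits)
        moreover from clos.step[OF pn[unfolded j True] pn[unfolded j True] config_step_intros(4)]
        have "config_clos (config K c (trm_encode (Ap_f t)) 1 p n d)" by (simp only: trm_encode.simps)
        ultimately show ?thesis by blast
      next
        case False
        then have mi: "m = 0" "i = 0" using m Main by (simp_all add: mk_state_def j Let_def split: if_splits)
        show ?thesis
        proof (cases "d = c")
          case True
          have "max a 1 * max b 1 dvd K" using K(2) by (rule dvd_mult_right)
          then have "max a 1 dvd K" "max b 1 dvd K" by (rule dvd_mult_left, rule dvd_mult_right)
          then have ab: "a = 0 \<or> a dvd K" "b = 0 \<or> b dvd K"
            by (cases a, simp_all) (cases b, simp_all)
          obtain x x' where q: "is_quotient K a x" "is_quotient K b x'"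
            using is_quotient_exists[OF ab(1)] is_quotient_exists[OF ab(2)] by (elim exE)
          from clos.step[OF pn[unfolded j True] pn[unfolded j True] config_step_intros(6)[OF False q]]
          have "config_clos (config K c (trm_encode (Ap_f t)) 0 (p + x) (n + x') 0)" by (simp only: trm_encode.simps)
          then show ?thesis unfolding mi by blast
        next
          case d: False
          from clos.step[OF pn[unfolded j] pn[unfolded j] config_step_intros(5)[OF False d]]
          have "config_clos (config K c (trm_encode (Ap_f t)) 0 p n 0)" by (simp only: trm_encode.simps)
          then show ?thesis unfolding mi by blast
        qed
      qed
    qed
  qed
qed

text \<open>A move touches a coordinate at most its index, and the index is at most the number of
  the term; hence finitely many coordinates determine a position.\<close>

lemma ev_bounded: "ev t = mk_state m \<gamma> i \<Longrightarrow> (m = 0 \<longrightarrow> i \<le> trm_encode t) \<and> (\<forall>c>trm_encode t. \<gamma> c = 0)"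
proof (induction t arbitrary: m \<gamma> i)
  case Gen
  then show ?case by (auto simp: mk_state_def split: if_splits)
next
  case (Ap_g t)
  show ?case
  proof (cases "ev t")
    case (Main \<gamma>' j)
    then have "ev t = mk_state 0 \<gamma>' j" by (simp add: mk_state_def)
    from Ap_g.IH[OF this] Ap_g.prems Main show ?thesis by (auto simp: mk_state_def split: if_splits)
  next
    case (Tst \<gamma>' j)
    then have "ev t = mk_state 1 \<gamma>' j" by (simp add: mk_state_def)
    from Ap_g.IH[OF this] Ap_g.prems Tst show ?thesis by (auto simp: mk_state_def split: if_splits)
  qed
next
  case (Ap_f t)
  show ?case
  proof (cases "ev t")
    case (Main \<gamma>' j)
    then have "ev t = mk_state 0 \<gamma>' j" by (simp add: mk_state_def)
    from Ap_f.IH[OF this] have IH: "j \<le> trm_encode t" "\<forall>c>trm_encode t. \<gamma>' c = 0" by simp_all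
    have "p1 j \<le> j" using le_pr(1)[of "p1 j" "p2 j"] by simp
    then have "p1 j \<le> trm_encode t" using IH(1) by simp
    with IH(2) Ap_f.prems Main show ?thesis by (auto simp: mk_state_def Let_def split: if_splits)
  next
    case (Tst \<gamma>' j)
    then have "ev t = mk_state 1 \<gamma>' j" by (simp add: mk_state_def)
    from Ap_f.IH[OF this] Ap_f.prems Tst show ?thesis by (auto simp: mk_state_def split: if_splits)
  qed
qed

lemma mk_state_exhaust: obtains m \<gamma> i where "\<sigma> = mk_state m \<gamma> i" "m < 2"
proof (cases \<sigma>)
  case (Main \<gamma> i)
  then show ?thesis using that[of 0 \<gamma> i] by (simp add: mk_state_def)
next
  case (Tst \<gamma> i)
  then show ?thesis using that[of 1 \<gamma> i] by (simp add: mk_state_def)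
qed

lemma mk_state_eq_iff: "m < 2 \<Longrightarrow> m' < 2 \<Longrightarrow> mk_state m \<gamma> i = mk_state m' \<gamma>' i' \<longleftrightarrow> m = m' \<and> \<gamma> = \<gamma>' \<and> i = i'"
  by (auto simp: mk_state_def)

section \<open>Equality of states and passing of tests on codes\<close>

text \<open>By \<open>ev_bounded\<close> the coordinates up to \<open>s + t\<close> suffice, which
  keeps the universal quantifier bounded. The last equation compares the differences
  \<open>p - n\<close> and \<open>p' - n'\<close> over one denominator.\<close>

definition same_code :: "nat \<Rightarrow> nat \<Rightarrow> bool" where
  "same_code s t \<longleftrightarrow> (\<forall>c<Suc (s + t). \<exists>K m i p n p' n'. 0 < K \<and>
     config_clos (config K c s m p n i) \<and> config_clos (config K c t m p' n' i) \<and> p + n' = p' + n)"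

lemma same_code_iff: "same_code (trm_encode s) (trm_encode t) \<longleftrightarrow> ev s = ev t"
proof
  assume same: "same_code (trm_encode s) (trm_encode t)"
  obtain m \<gamma> i where s: "ev s = mk_state m \<gamma> i" "m < 2" by (rule mk_state_exhaust)
  obtain m' \<gamma>' i' where t: "ev t = mk_state m' \<gamma>' i'" "m' < 2" by (rule mk_state_exhaust)
  have *: "m = m' \<and> i = i' \<and> \<gamma> c = \<gamma>' c" if c: "c < Suc (trm_encode s + trm_encode t)" for c
  proof -
    obtain K m0 i0 p n p' n' where K: "0 < K" and
      cs: "config_clos (config K c (trm_encode s) m0 p n i0)" and
      ct: "config_clos (config K c (trm_encode t) m0 p' n' i0)" and eq: "p + n' = p' + n"
      using same[unfolded same_code_def, THEN spec, THEN mp, OF c] by (elim exE conjE)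
    obtain \<gamma>1 where 1: "m0 < 2" "ev s = mk_state m0 \<gamma>1 i0" "of_nat p - of_nat n = of_nat K * \<gamma>1 c"
      using config_sound[OF cs] K unfolding config_meaning_config trm_decode_enc by blast
    obtain \<gamma>2 where 2: "ev t = mk_state m0 \<gamma>2 i0" "of_nat p' - of_nat n' = of_nat K * \<gamma>2 c"
      using config_sound[OF ct] K unfolding config_meaning_config trm_decode_enc by blast
    have "of_nat p + of_nat n' = (of_nat p' + of_nat n :: rat)"
      using eq by (metis of_nat_add)
    then have "of_nat p - of_nat n = (of_nat p' - of_nat n' :: rat)" by (simp add: algebra_simps)
    then have "\<gamma>1 c = \<gamma>2 c" using 1(3) 2(2) K by simp
    moreover have "m = m0 \<and> \<gamma> = \<gamma>1 \<and> i = i0" using s 1(1,2) mk_state_eq_iff by simp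
    moreover have "m' = m0 \<and> \<gamma>' = \<gamma>2 \<and> i' = i0" using t 1(1) 2(1) mk_state_eq_iff by simp
    ultimately show ?thesis by simp
  qed
  have "\<gamma> c = \<gamma>' c" for c
  proof (cases "c < Suc (trm_encode s + trm_encode t)")
    case False
    then show ?thesis using ev_bounded[OF s(1)] ev_bounded[OF t(1)] by simp
  qed (use * in blast)
  then have "\<gamma> = \<gamma>'" by (rule ext)
  moreover have "m = m'" "i = i'" using *[of 0] by simp_all
  ultimately show "ev s = ev t" unfolding s t by simp
next
  assume eq: "ev s = ev t"
  show "same_code (trm_encode s) (trm_encode t)"
    unfolding same_code_def
  proof (intro allI impI)
    fix c
    obtain m \<gamma> i where s: "ev s = mk_state m \<gamma> i" "m < 2" by (rule mk_state_exhaust)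
    obtain K1 where K1: "0 < K1" "\<forall>K>0. K1 dvd K \<longrightarrow> (\<forall>m \<gamma> i. m < 2 \<longrightarrow> ev s = mk_state m \<gamma> i \<longrightarrow>
        (\<exists>p n. config_clos (config K c (trm_encode s) m p n i)))"
      using config_complete[of s c] by (elim exE conjE)
    obtain K2 where K2: "0 < K2" "\<forall>K>0. K2 dvd K \<longrightarrow> (\<forall>m \<gamma> i. m < 2 \<longrightarrow> ev t = mk_state m \<gamma> i \<longrightarrow>
        (\<exists>p n. config_clos (config K c (trm_encode t) m p n i)))"
      using config_complete[of t c] by (elim exE conjE)
    \<comment> \<open>The product is a common denominator for both terms.\<close>
    have K: "0 < K1 * K2" using K1(1) K2(1) by simp
    obtain p n where cs: "config_clos (config (K1 * K2) c (trm_encode s) m p n i)"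
      using K1(2)[rule_format, OF K _ s(2,1)] by auto
    obtain p' n' where ct: "config_clos (config (K1 * K2) c (trm_encode t) m p' n' i)"
      using K2(2)[rule_format, OF K _ s(2) s(1)[unfolded eq]] by auto
    obtain \<gamma>1 where 1: "ev s = mk_state m \<gamma>1 i" "of_nat p - of_nat n = of_nat (K1 * K2) * \<gamma>1 c"
      using config_sound[OF cs] K unfolding config_meaning_config trm_decode_enc by blast
    obtain \<gamma>2 where 2: "ev t = mk_state m \<gamma>2 i" "of_nat p' - of_nat n' = of_nat (K1 * K2) * \<gamma>2 c"
      using config_sound[OF ct] K unfolding config_meaning_config trm_decode_enc by blast
    have "\<gamma>1 = \<gamma>2" using 1(1) 2(1) eq s(2) mk_state_eq_iff by metis
    then have "of_nat p - of_nat n = (of_nat p' - of_nat n' :: rat)" using 1(2) 2(2) by simp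
    then have "of_nat (p + n') = (of_nat (p' + n) :: rat)" by (simp add: algebra_simps)
    then have "p + n' = p' + n" using of_nat_eq_iff by blast
    with K cs ct show "\<exists>K m i p n p' n'. 0 < K \<and>
     config_clos (config K c (trm_encode s) m p n i) \<and> config_clos (config K c (trm_encode t) m p' n' i) \<and> p + n' = p' + n"
      by blast
  qed
qed

text \<open>With \<open>d = K / k\<close>, the inequality \<open>(p - n) / K < - 1 / k\<close>
  becomes \<open>p + d < n\<close>. The tracked coordinate is also the tested one, so
  \<open>c\<close> occurs twice.\<close>

definition passes_code :: "(nat \<Rightarrow> nat \<Rightarrow> bool) \<Rightarrow> nat \<Rightarrow> bool" where
  "passes_code M s \<longleftrightarrow> (\<exists>K c p n k d. 0 < K \<and> 0 < k \<and> d * k = K \<and> p + d < n \<and> M c k \<and>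
     config_clos (config K c s 1 p n c))"

lemma passes_code_iff: "passes_code M (trm_encode s) \<longleftrightarrow> passes M (ev s)"
proof
  assume "passes_code M (trm_encode s)"
  then obtain K c p n k d where K: "0 < K" and k: "0 < k" "d * k = K" "p + d < n" "M c k"
    and cs: "config_clos (config K c (trm_encode s) 1 p n c)"
    unfolding passes_code_def by (elim exE conjE)
  obtain \<gamma> where \<gamma>: "ev s = Tst \<gamma> c" "of_nat p - of_nat n = of_nat K * \<gamma> c"
    using config_sound[OF cs] K unfolding config_meaning_config trm_decode_enc mk_state_def by auto
  have "of_nat p + of_nat d < (of_nat n :: rat)"
    using k(3) by (metis of_nat_add of_nat_less_iff)
  then have "of_nat K * \<gamma> c < - of_nat d" using \<gamma>(2) by simp
  moreover have "- of_nat d = of_nat K * (- 1 / of_nat k :: rat)"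
    using k(1) unfolding k(2)[symmetric] by simp
  ultimately have "\<gamma> c < - 1 / of_nat k"
    using K by (metis mult_less_cancel_left_pos of_nat_0_less_iff)
  then show "passes M (ev s)" using \<gamma>(1) k by auto
next
  assume "passes M (ev s)"
  then obtain \<gamma> c k where s: "ev s = Tst \<gamma> c" and k: "0 < k" "M c k" "\<gamma> c < - 1 / of_nat k"
    by (cases "ev s") auto
  obtain K0 where K0: "0 < K0" "\<forall>K>0. K0 dvd K \<longrightarrow> (\<forall>m \<gamma> i. m < 2 \<longrightarrow> ev s = mk_state m \<gamma> i \<longrightarrow>
      (\<exists>p n. config_clos (config K c (trm_encode s) m p n i)))"
    using config_complete[of s c] by (elim exE conjE)
  \<comment> \<open>The factor \<open>k\<close> makes \<open>1 / k\<close> a multiple of the unit;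
    then \<open>d = K0\<close>.\<close>
  have K: "0 < K0 * k" using K0(1) k(1) by simp
  have s': "ev s = mk_state 1 \<gamma> c" by (simp add: s mk_state_def)
  obtain p n where cs: "config_clos (config (K0 * k) c (trm_encode s) 1 p n c)"
    using K0(2)[rule_format, OF K _ _ s'] by auto
  obtain \<gamma>' where \<gamma>': "ev s = mk_state 1 \<gamma>' c" "of_nat p - of_nat n = of_nat (K0 * k) * \<gamma>' c"
    using config_sound[OF cs] K unfolding config_meaning_config trm_decode_enc by blast
  have "\<gamma>' = \<gamma>" using \<gamma>'(1) s by (simp add: mk_state_def)
  have "of_nat (K0 * k) * \<gamma> c < of_nat (K0 * k) * (- 1 / of_nat k)"
    using k(3) K by (simp only: mult_less_cancel_left_pos of_nat_0_less_iff)
  also have "\<dots> = - of_nat K0" using k(1) by simp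
  finally have "of_nat p - of_nat n < (- of_nat K0 :: rat)" using \<gamma>'(2) unfolding \<open>\<gamma>' = \<gamma>\<close> by simp
  then have "of_nat (p + K0) < (of_nat n :: rat)" by simp
  then have "p + K0 < n" by (simp only: of_nat_less_iff)
  with K k cs show "passes_code M (trm_encode s)"
    unfolding passes_code_def by blast
qed

lemma semidec_ker:
  assumes "semidec (\<lambda>z. M (p1 z) (p1 (p2 z)) (p2 (p2 z)))"
  shows "semidec (\<lambda>z. ker (M (p1 z)) (trm_decode (p1 (p2 z))) (trm_decode (p2 (p2 z))))"
proof -
  have M: "semidec (\<lambda>z. M (F z) (G z) (H z))" if "computable F" "computable G" "computable H" for F G H
    using semidec_compose[OF assms computable_pr[OF that(1) computable_pr[OF that(2,3)]]] by simp
  have "semidec (\<lambda>z. config_clos z)"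
    unfolding config_base_def config_step_def config_def is_quotient_def
    by (rule semidec_clos semidec_intros semidec_dec[OF dec_eq] semidec_dec[OF dec_not] dec_eq computable_intros)+
  from semidec_compose[OF this] have C: "semidec (\<lambda>z. config_clos (F z))" if "computable F" for F
    using that by blast
  have ker: "ker N s t \<longleftrightarrow> same_code (trm_encode s) (trm_encode t) \<or> passes_code N (trm_encode s) \<and> passes_code N (trm_encode t)" for N s t
    unfolding ker_def same_code_iff passes_code_iff ..
  show ?thesis
    unfolding ker trm_decode_enc same_code_def passes_code_def config_def
    by (rule semidec_intros semidec_dec[OF dec_eq] semidec_dec[OF dec_less] C M computable_intros)+
qed

lemma Sigma03_reducible_iso_UF2_1:
  assumes "equivp E" "Sigma03 E"
  shows "E \<le>\<^sub>c iso_UF2_1"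
proof -
  obtain M where M: "semidec (\<lambda>z. M (p1 z) (p1 (p2 z)) (p2 (p2 z)))" "\<And>x c. cut_family (M x c)"
    "\<And>x y. E x y \<longleftrightarrow> finite {c. M x c \<noteq> M y c}"
    by (rule Sigma03_cut_families[OF assms]) (rule that)
  \<comment> \<open>The presentation of \<open>x\<close> lists all pairs of its kernel; by
    \<open>tcong_ker\<close> they generate nothing more.\<close>
  obtain h where h: "computable h"
    "\<And>x. W (h x) = {y. ker (M (p1 (pr x y))) (trm_decode (p1 (p2 (pr x y)))) (trm_decode (p2 (p2 (pr x y))))}"
    by (rule semidec_parametrization[OF semidec_ker[OF M(1)]]) (rule that)
  have "{p. pair_encode p \<in> W (h x)} = {(s, t). ker (M x) s t}" for x
    unfolding h(2) pr_simps pair_encode_def pr_def[symmetric] by auto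
  then have term_eq: "term_eq (h x) s t \<longleftrightarrow> ker (M x) s t" for x s t
    by (simp add: term_eq_def tcong_ker)
  have "E x y \<longleftrightarrow> iso_UF2_1 (h x) (h y)" for x y
    unfolding iso_UF2_1_iff term_eq M(3)
  proof
    assume "finite {c. M x c \<noteq> M y c}"
    then show "\<exists>u v. ker (M y) (subst u v) Gen \<and> (\<forall>s t. ker (M x) s t \<longleftrightarrow> ker (M y) (subst u s) (subst u t))"
      by (rule ker_embedding[OF M(2) M(2)])
  next
    assume "\<exists>u v. ker (M y) (subst u v) Gen \<and> (\<forall>s t. ker (M x) s t \<longleftrightarrow> ker (M y) (subst u s) (subst u t))"
    then obtain u v where "ker (M y) (subst u v) Gen"
      "\<forall>s t. ker (M x) s t \<longleftrightarrow> ker (M y) (subst u s) (subst u t)" by (elim exE conjE)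
    then show "finite {c. M x c \<noteq> M y c}"
      by (intro ker_embedding_imp_finite[OF M(2) M(2)]) simp_all
  qed
  with h(1) show ?thesis unfolding computably_reducible_def by blast
qed

theorem theorem5p3: "Sigma03_complete_equivalence iso_UF2_1"
  unfolding Sigma03_complete_equivalence_def
  using equivp_iso_UF2_1 Sigma03_iso_UF2_1 Sigma03_reducible_iso_UF2_1 by simp

end
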